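(* Let $\mu$ be a probability measure on $\Omega$ which is stationary ergodic with respect to the $\mathbb Z$-shift $\theta$ and elliptic. Then there is a deterministic $v\in[-1,1]$ such that $\mathbb P_0\big(\lim_{n\to\infty}X_n/n=v\big)=1$.
   Context: Notation: $\mathbb N=\{1,2,\dots\}$. A cookie environment is $\omega\in\Omega=[0,1]^{\mathbb Z\times\mathbb N}$ (with the product Borel $\sigma$-algebra); $\omega(x,n)$ is the $n$-th cookie at site $x$. The shift $\theta$ acts by $(\theta\omega)(x,n)=\omega(x+1,n)$. A probability measure $\mu$ on $\Omega$ is stationary ergodic if it is $\theta$-invariant and ergodic for $\theta$, and elliptic if $\mu((0,1)^{\mathbb Z\times\mathbb N})=1$. For $\omega\in\Omega$ and $x\in\mathbb Z$, the excited random walk under $P_{\omega,x}$ is the process $(X_n)_{n\ge0}$ with $X_0=x$ and, conditionally on $X_0,\dots,X_{n-1}$, $X_n=X_{n-1}+1$ with probability $\omega(X_{n-1},\#\{k\le n-1:X_k=X_{n-1}\})$ and $X_n=X_{n-1}-1$ otherwise. The annealed law is $\mathbb P_x(\cdot)=\int_\Omega P_{\omega,x}(\cdot)\,d\mu(\omega)$. *)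

theory Defs
  imports "HOL-Probability.Probability"
begin

text \<open>Cookie environments: omega x k is the (k+1)-th cookie at site x
  (0-based cookie index, so omega x 0 is the first cookie).\<close>
type_synonym cookie_env = "int \<Rightarrow> nat \<Rightarrow> real"

definition cookie_M :: "cookie_env measure" where
  "cookie_M = PiM UNIV (\<lambda>_::int. PiM UNIV (\<lambda>_::nat. (borel :: real measure)))"

definition shift :: "cookie_env \<Rightarrow> cookie_env" where
  "shift \<omega> = (\<lambda>x n. \<omega> (x + 1) n)"

definition stationary :: "cookie_env measure \<Rightarrow> bool" where
  "stationary \<mu> \<longleftrightarrow> shift \<in> measurable \<mu> \<mu> \<and> distr \<mu> \<mu> shift = \<mu>"

definition ergodic :: "cookie_env measure \<Rightarrow> bool" where
  "ergodic \<mu> \<longleftrightarrow> (\<forall>A\<in>sets \<mu>. shift -` A \<inter> space \<mu> = A \<longrightarrow>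
      emeasure \<mu> A = 0 \<or> emeasure \<mu> A = 1)"

definition elliptic :: "cookie_env measure \<Rightarrow> bool" where
  "elliptic \<mu> \<longleftrightarrow> (AE \<omega> in \<mu>. \<forall>x n. 0 < \<omega> x n \<and> \<omega> x n < 1)"

text \<open>Excited random walk driven by i.i.d. uniform variables U:
  at step n+1, from y = X n, visited k times so far (including time n),
  jump right iff U n < omega y (k-1), i.e. with probability omega(y,k).\<close>
primrec erw_path :: "int \<Rightarrow> cookie_env \<Rightarrow> (nat \<Rightarrow> real) \<Rightarrow> nat \<Rightarrow> int list" where
  "erw_path x0 \<omega> U 0 = [x0]"
| "erw_path x0 \<omega> U (Suc n) =
     (let p = erw_path x0 \<omega> U n; y = last p; k = count_list p y
      in p @ [if U n < \<omega> y (k - 1) then y + 1 else y - 1])"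

definition erw :: "int \<Rightarrow> cookie_env \<Rightarrow> (nat \<Rightarrow> real) \<Rightarrow> nat \<Rightarrow> int" where
  "erw x0 \<omega> U n = last (erw_path x0 \<omega> U n)"

definition uniforms :: "(nat \<Rightarrow> real) measure" where
  "uniforms = PiM UNIV (\<lambda>_::nat. uniform_measure lborel {0..1::real})"

definition annealed :: "cookie_env measure \<Rightarrow> (cookie_env \<times> (nat \<Rightarrow> real)) measure" where
  "annealed \<mu> = \<mu> \<Otimes>\<^sub>M uniforms"

end

theory Submission
  imports Defs
begin

text \<open>
  Attach to every site a stack of arrows, the \<open>k\<close>-th arrow at \<open>x\<close> pointing right iff
  an independent uniform variable is below the \<open>k\<close>-th cookie at \<open>x\<close>; following the arrows gives a walk
  with the law of the excited random walk, and the arrow field is stationary and ergodic.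
  Let \<open>Z x\<close> be the number of left jumps from \<open>x\<close> of a walk that comes from \<open>-\<infinity>\<close> and
  escapes to \<open>+\<infinity>\<close>.  It is the increasing limit of a branching process with
  immigration that is run from right to left; write \<open>E\<close> for the mean of \<open>Z 0\<close>.
  When the walk started at \<open>0\<close> is at \<open>m > 0\<close>, its left jumps from \<open>x \<in> [0, m)\<close> already dominate
  the truncation of \<open>Z x\<close> at \<open>m\<close>; as time equals position plus twice the number of left jumps,
  the ergodic theorem yields \<open>limsup X\<^sub>n / n \<le> 1 / (1 + 2 E)\<close>, read as \<open>0\<close> if \<open>E\<close> is infinite.
  If \<open>E\<close> is finite, the number of left jumps from \<open>x\<close> never exceeds \<open>Z x\<close>, whatever the walk does.
  By ellipticity and ergodicity \<open>Z x = 0\<close> for some \<open>x \<le> 0\<close>, so the walk stays to the right of it, and summing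
  \<open>Z\<close> up to the running maximum gives the matching lower bound.  The reflected field covers
  the left direction, and if both means are infinite then the speed is \<open>0\<close>.
\<close>


subsection \<open>Walks driven by arrow fields\<close>

text \<open>\<open>visits a t x\<close> counts times strictly before \<open>t\<close>, so at the
  current site it is the 0-based index of the next fresh arrow. Position and visit counts determine
  each other's next values, hence the mutual recursion.\<close>

fun walk :: "(int \<Rightarrow> nat \<Rightarrow> bool) \<Rightarrow> nat \<Rightarrow> int"
  and visits :: "(int \<Rightarrow> nat \<Rightarrow> bool) \<Rightarrow> nat \<Rightarrow> int \<Rightarrow> nat" where
  "walk a 0 = 0"
| "walk a (Suc t) = (if a (walk a t) (visits a t (walk a t)) then walk a t + 1 else walk a t - 1)"
| "visits a 0 x = 0"
| "visits a (Suc t) x = visits a t x + of_bool (walk a t = x)"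

section \<open>Arrows read from a stack and jumps of the walk\<close>

definition rights :: "(nat \<Rightarrow> bool) \<Rightarrow> nat \<Rightarrow> nat" where
  "rights b n = (\<Sum>k<n. of_bool (b k))"

definition lefts :: "(nat \<Rightarrow> bool) \<Rightarrow> nat \<Rightarrow> nat" where
  "lefts b n = (\<Sum>k<n. of_bool (\<not> b k))"

lemma rights_simps [simp]: "rights b 0 = 0" "rights b (Suc n) = rights b n + of_bool (b n)"
  by (simp_all add: rights_def)

lemma lefts_simps [simp]: "lefts b 0 = 0" "lefts b (Suc n) = lefts b n + of_bool (\<not> b n)"
  by (simp_all add: lefts_def)

lemma rights_mono: "m \<le> n \<Longrightarrow> rights b m \<le> rights b n"
  unfolding rights_def by (rule sum_mono2) auto

lemma lefts_mono: "m \<le> n \<Longrightarrow> lefts b m \<le> lefts b n"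
  unfolding lefts_def by (rule sum_mono2) auto

definition right_jumps :: "(int \<Rightarrow> nat \<Rightarrow> bool) \<Rightarrow> nat \<Rightarrow> int \<Rightarrow> nat" where
  "right_jumps a t x = rights (a x) (visits a t x)"

definition left_jumps :: "(int \<Rightarrow> nat \<Rightarrow> bool) \<Rightarrow> nat \<Rightarrow> int \<Rightarrow> nat" where
  "left_jumps a t x = lefts (a x) (visits a t x)"

lemma right_jumps_simps [simp]:
  "right_jumps a 0 x = 0"
  "right_jumps a (Suc t) x = right_jumps a t x + of_bool (walk a t = x \<and> walk a (Suc t) = x + 1)"
  by (auto simp: right_jumps_def)

lemma left_jumps_simps [simp]:
  "left_jumps a 0 x = 0"
  "left_jumps a (Suc t) x = left_jumps a t x + of_bool (walk a t = x \<and> walk a (Suc t) = x - 1)"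
  by (auto simp: left_jumps_def)

text \<open>Crossings of the edge between \<open>x\<close> and \<open>x + 1\<close> alternate in
  direction, so their net number depends only on the sides of the edge on which \<open>0\<close> and
  \<open>walk a t\<close> lie. The indicators record the two cases with opposite sides.\<close>

lemma edge_flow:
  "int (right_jumps a t x) + of_bool (walk a t \<le> x \<and> x < 0)
     = int (left_jumps a t (x + 1)) + of_bool (0 \<le> x \<and> x < walk a t)"
  by (induction t) auto

lemma walk_abs_le: "\<bar>walk a t\<bar> \<le> int t"
  by (induction t) auto

text \<open>Position is right jumps minus left jumps, and time is their sum. The set
  \<open>S\<close> only has to contain the sites occupied before time \<open>t\<close>.\<close>

lemma walk_plus_left_jumps:
  assumes "finite S" "\<And>i. i < t \<Longrightarrow> walk a i \<in> S"
  shows "walk a t + 2 * (\<Sum>x\<in>S. int (left_jumps a t x)) = int t"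
  using assms(2)
proof (induction t)
  case (Suc t)
  have "(\<Sum>x\<in>S. of_bool (walk a t = x \<and> walk a (Suc t) = x - 1))
      = (\<Sum>x\<in>S. if x = walk a t then of_bool (walk a (Suc t) = walk a t - 1) else 0 :: int)"
    by (rule sum.cong) auto
  also have "\<dots> = of_bool (walk a (Suc t) = walk a t - 1)"
    using Suc.prems \<open>finite S\<close> by simp
  finally have "(\<Sum>x\<in>S. int (left_jumps a (Suc t) x))
      = (\<Sum>x\<in>S. int (left_jumps a t x)) + of_bool (walk a (Suc t) = walk a t - 1)"
    by (simp only: left_jumps_simps of_nat_add of_nat_of_bool sum.distrib)
  moreover have "walk a (Suc t) = walk a t + 1 - 2 * of_bool (walk a (Suc t) = walk a t - 1)"
    by simp
  moreover have "walk a t + 2 * (\<Sum>x\<in>S. int (left_jumps a t x)) = int t"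
    using Suc by simp
  ultimately show ?case
    unfolding of_nat_Suc by linarith
qed simp

lemma walk_plus_left_jumps_le:
  assumes "finite S"
  shows "walk a t + 2 * (\<Sum>x\<in>S. int (left_jumps a t x)) \<le> int t"
proof -
  have "(\<Sum>x\<in>S. int (left_jumps a t x)) \<le> (\<Sum>x\<in>S \<union> walk a ` {..<t}. int (left_jumps a t x))"
    using assms by (intro sum_mono2) auto
  then show ?thesis
    using walk_plus_left_jumps[of "S \<union> walk a ` {..<t}" t a] assms by auto
qed

lemma left_jumps_eq_0: "\<forall>i<t. walk a i \<noteq> x \<Longrightarrow> left_jumps a t x = 0"
  by (induction t) auto

definition mirror :: "(int \<Rightarrow> nat \<Rightarrow> bool) \<Rightarrow> int \<Rightarrow> nat \<Rightarrow> bool" where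
  "mirror a x k = (\<not> a (- x) k)"

lemma walk_visits_mirror: "walk (mirror a) t = - walk a t \<and> (\<forall>x. visits (mirror a) t x = visits a t (- x))"
  by (induction t) (auto simp: mirror_def)

lemma walk_mirror: "walk (mirror a) t = - walk a t"
  using walk_visits_mirror by blast

text \<open>Upper bound for the number of left jumps from a site before the \<open>r\<close>-th right jump
  from it (exactly that number if the stack contains \<open>r\<close> right arrows).\<close>

definition offspring :: "(nat \<Rightarrow> bool) \<Rightarrow> ennreal \<Rightarrow> ennreal" where
  "offspring b r = (SUP n. if of_nat (rights b n) < r then of_nat (lefts b n) else 0)"

lemma offspring_ge: "of_nat (rights b n) < r \<Longrightarrow> of_nat (lefts b n) \<le> offspring b r"
  unfolding offspring_def by (rule SUP_upper2[of n]) auto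

lemma offspring_mono: "r \<le> r' \<Longrightarrow> offspring b r \<le> offspring b r'"
  unfolding offspring_def by (rule SUP_mono') auto

text \<open>\<open>branch k a x\<close> is the number of left jumps from \<open>x\<close> of a walk coming from the left,
  before it hits \<open>x + k\<close>.  Read from right to left, it is a branching process
  with one immigrant per generation.\<close>

primrec branch :: "nat \<Rightarrow> (int \<Rightarrow> nat \<Rightarrow> bool) \<Rightarrow> int \<Rightarrow> ennreal" where
  "branch 0 a x = 0"
| "branch (Suc k) a x = offspring (a x) (branch k a (x + 1) + 1)"

definition total_branch :: "(int \<Rightarrow> nat \<Rightarrow> bool) \<Rightarrow> int \<Rightarrow> ennreal" where
  "total_branch a x = (SUP k. branch k a x)"

section \<open>Monotonicity, locality and limits of the branching process\<close>

lemma branch_le_Suc: "branch k a x \<le> branch (Suc k) a x"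
proof (induction k arbitrary: x)
  case (Suc k)
  have "offspring (a x) (branch k a (x + 1) + 1) \<le> offspring (a x) (branch (Suc k) a (x + 1) + 1)"
    by (intro offspring_mono add_right_mono Suc)
  then show ?case by simp
qed simp

lemma incseq_branch: "incseq (\<lambda>k. branch k a x)"
  by (rule incseq_SucI) (rule branch_le_Suc)

lemma branch_le_total: "branch k a x \<le> total_branch a x"
  unfolding total_branch_def by (rule SUP_upper) simp

text \<open>Generations are read from sites further and further right, so arrows left of
  \<open>x\<close> never enter. This later makes events about site \<open>1\<close> independent of
  the arrows at \<open>0\<close>, given the cookies.\<close>

lemma branch_cong_right: "(\<And>y. x \<le> y \<Longrightarrow> a y = a' y) \<Longrightarrow> branch k a x = branch k a' x"
  by (induction k arbitrary: x) auto

lemma total_branch_cong_right: "(\<And>y. x \<le> y \<Longrightarrow> a y = a' y) \<Longrightarrow> total_branch a x = total_branch a' x"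
  unfolding total_branch_def using branch_cong_right by metis

lemma branch_translate: "branch k (\<lambda>x. a (x + y)) x = branch k a (x + y)"
  by (induction k arbitrary: x) (simp_all add: ac_simps)

lemma total_branch_translate: "total_branch (\<lambda>x. a (x + y)) x = total_branch a (x + y)"
  by (simp add: total_branch_def branch_translate)

text \<open>The branching recursion passes to the limit: a strict bound by a supremum already holds
  at some finite depth \<open>k\<close>, where \<open>offspring_ge\<close> applies.\<close>

lemma lefts_le_total_branch:
  assumes "of_nat (rights (a x) n) < total_branch a (x + 1) + 1"
  shows "of_nat (lefts (a x) n) \<le> total_branch a x"
proof -
  have "total_branch a (x + 1) + 1 = (SUP k. branch k a (x + 1) + 1)"
    unfolding total_branch_def by (subst ennreal_SUP_add_left) auto
  with assms obtain k where "of_nat (rights (a x) n) < branch k a (x + 1) + 1"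
    by (auto simp: less_SUP_iff)
  then have "of_nat (lefts (a x) n) \<le> branch (Suc k) a x"
    by (simp add: offspring_ge)
  also have "\<dots> \<le> total_branch a x" by (rule branch_le_total)
  finally show ?thesis .
qed

text \<open>With at most \<open>m\<close> left jumps from \<open>x + 1\<close> and one immigrant, at
  most \<open>m + 1\<close> right jumps from \<open>x\<close> are required. The arrows with indices
  \<open>0\<close> to \<open>m\<close> supply them before any left arrow is read.\<close>

lemma total_branch_eq_0I:
  assumes "total_branch a (x + 1) \<le> of_nat m" and "\<And>k. k \<le> m \<Longrightarrow> a x k"
  shows "total_branch a x = 0"
proof -
  have "branch k a x = 0" for k
  proof (cases k)
    case (Suc j)
    have "lefts (a x) n = 0" if "of_nat (rights (a x) n) < branch j a (x + 1) + 1" for n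
    proof -
      note that
      also have "branch j a (x + 1) + 1 \<le> of_nat (m + 1)"
        using order_trans[OF branch_le_total assms(1)] by (simp add: add.commute add_mono)
      finally have "rights (a x) n < m + 1" by (simp only: of_nat_less_iff)
      moreover have "rights (a x) (m + 1) = m + 1"
        using assms(2) by (simp add: rights_def)
      ultimately have "n \<le> m"
        using rights_mono[of "m + 1" n "a x"] by (cases "n \<le> m") auto
      then show ?thesis using assms(2) by (simp add: lefts_def)
    qed
    then have "(if of_nat (rights (a x) n) < branch j a (x + 1) + 1 then of_nat (lefts (a x) n) else 0)
        = (0 :: ennreal)" for n
      by simp
    then show ?thesis by (simp only: Suc branch.simps offspring_def) simp
  qed simp
  then show ?thesis by (simp add: total_branch_def)
qed

text \<open>A walk now to the right of \<open>x \<ge> 0\<close> has made exactly one more right jump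
  from \<open>x\<close> than left jumps from \<open>x + 1\<close>, the extra one being the
  immigrant. Monotonicity of \<open>offspring\<close> then carries the bound from
  \<open>x + 1\<close> to \<open>x\<close>.\<close>

lemma branch_le_left_jumps:
  assumes "0 \<le> x" "x + int k \<le> walk a t"
  shows "branch k a x \<le> of_nat (left_jumps a t x)"
  using assms
proof (induction k arbitrary: x)
  case (Suc k)
  have eq: "right_jumps a t x = left_jumps a t (x + 1) + 1"
    using edge_flow[of a t x] Suc.prems by simp
  have "branch (Suc k) a x \<le> offspring (a x) (of_nat (left_jumps a t (x + 1)) + 1)"
    using Suc by (auto intro!: offspring_mono add_right_mono)
  also have "\<dots> = offspring (a x) (of_nat (right_jumps a t x))"
    by (simp add: eq add.commute)
  also have "\<dots> \<le> of_nat (left_jumps a t x)"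
    unfolding offspring_def
  proof (rule SUP_least)
    fix n
    have "lefts (a x) n \<le> left_jumps a t x" if "rights (a x) n < right_jumps a t x"
    proof -
      have "n < visits a t x"
        using that rights_mono[of "visits a t x" n "a x"] by (cases "n < visits a t x") (auto simp: right_jumps_def)
      then show ?thesis by (auto simp: left_jumps_def intro: lefts_mono)
    qed
    then show "(if of_nat (rights (a x) n) < (of_nat (right_jumps a t x) :: ennreal) then of_nat (lefts (a x) n) else 0)
        \<le> (of_nat (left_jumps a t x) :: ennreal)"
      by simp
  qed
  finally show ?case .
qed simp

text \<open>If the bound fails at \<open>x\<close> when the walk is at or to the left of \<open>x\<close>, then comparing
  the numbers of used arrows at \<open>x\<close> shows that it also fails at \<open>x + 1\<close>, and so on; but only
  finitely many sites have been visited.\<close>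

lemma left_jumps_le_total_branch:
  assumes fin: "\<And>x. total_branch a x < \<infinity>"
  shows "of_nat (left_jumps a t x) \<le> total_branch a x"
proof (induction t arbitrary: x)
  case (Suc t)
  let ?L = "left_jumps a (Suc t)" and ?R = "right_jumps a (Suc t)"
  show ?case
  proof (cases "walk a (Suc t) \<le> x")
    case True
    show ?thesis
    proof (rule ccontr)
      assume bad: "\<not> of_nat (?L x) \<le> total_branch a x"
      have "total_branch a (x + int n) < of_nat (?L (x + int n))" for n
      proof (induction n)
        case 0
        show ?case using bad by simp
      next
        case (Suc n)
        let ?z = "x + int n"
        have "\<not> of_nat (?R ?z) < total_branch a (?z + 1) + 1"
          using lefts_le_total_branch[of a ?z "visits a (Suc t) ?z"] Suc
          by (auto simp: right_jumps_def left_jumps_def simp del: visits.simps)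
        \<comment> \<open>Finiteness makes this inequality strict, which keeps the failure strict at
          the next site.\<close>
        moreover have "total_branch a (?z + 1) < total_branch a (?z + 1) + 1"
          using fin[of "?z + 1"] by (cases "total_branch a (?z + 1)") (auto simp: ennreal_less_iff simp flip: ennreal_1 ennreal_plus)
        moreover have "?R ?z \<le> ?L (?z + 1)"
          using edge_flow[of a "Suc t" ?z] True
          by (cases "?z < 0") (simp_all del: walk.simps right_jumps_simps left_jumps_simps)
        then have "of_nat (?R ?z) \<le> (of_nat (?L (?z + 1)) :: ennreal)"
          by (simp only: of_nat_le_iff)
        ultimately have "total_branch a (?z + 1) < of_nat (?L (?z + 1))"
          by (meson less_le_trans not_le)
        moreover have "?z + 1 = x + int (Suc n)"
          by simp
        ultimately show ?case by (simp only:)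
      qed
      \<comment> \<open>This site lies beyond \<open>t\<close>, so it cannot have been visited
        before time \<open>Suc t\<close>; yet the chain of failures produces a left jump from
        it.\<close>
      from this[of "nat (\<bar>x\<bar> + int t + 1)"]
      have "?L (x + int (nat (\<bar>x\<bar> + int t + 1))) \<noteq> 0"
        by (metis not_less_zero of_nat_0)
      with left_jumps_eq_0[of "Suc t" a "x + int (nat (\<bar>x\<bar> + int t + 1))"]
      obtain i where "i < Suc t" "walk a i = x + int (nat (\<bar>x\<bar> + int t + 1))"
        by metis
      then show False using walk_abs_le[of a i] by simp
    qed
  next
    case False
    \<comment> \<open>A last step ending to the right of \<open>x\<close> was not a left jump from
      \<open>x\<close>.\<close>
    then have "?L x = left_jumps a t x" by (simp add: not_le)
    then show ?thesis using Suc by (simp del: left_jumps_simps)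
  qed
qed simp

text \<open>The sites in \<open>[0, walk a t - k)\<close> lie at least \<open>k\<close> behind the
  walk, so their depth-\<open>k\<close> values are already realised as left jumps, each costing two
  units of time. The \<open>k\<close> sites left out cost at most \<open>c * k\<close>, which also
  covers the case \<open>walk a t \<le> k\<close>.\<close>

lemma walk_upper_bound:
  assumes g: "\<And>x. 0 \<le> g x" "\<And>x. ennreal (g x) \<le> branch k a (int x)"
    and C: "\<And>n. c * real n \<le> (\<Sum>x<n. g x) + C" and c: "0 \<le> c" and C0: "0 \<le> C"
  shows "real_of_int (walk a t) * (1 + 2 * c) \<le> real t + 2 * (C + c * real k)"
proof (cases "walk a t \<le> int k")
  case True
  have *: "real_of_int (walk a t) \<le> real t" using walk_abs_le[of a t] by linarith
  have "real_of_int (walk a t) * (2 * c) \<le> real k * (2 * c)"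
    using True c by (intro mult_right_mono) auto
  then show ?thesis using * C0 by (simp add: algebra_simps)
next
  case False
  define m where "m = nat (walk a t - int k)"
  have m: "real m = real_of_int (walk a t) - real k" using False by (simp add: m_def)
  have "g x \<le> real (left_jumps a t (int x))" if "x < m" for x
  proof -
    have "ennreal (g x) \<le> of_nat (left_jumps a t (int x))"
      by (rule order_trans[OF g(2) branch_le_left_jumps]) (use that in \<open>auto simp: m_def\<close>)
    then show ?thesis by (simp add: ennreal_of_nat_eq_real_of_nat)
  qed
  then have "(\<Sum>x<m. g x) \<le> (\<Sum>x<m. real (left_jumps a t (int x)))" by (intro sum_mono) auto
  also have "\<dots> = (\<Sum>x\<in>int ` {..<m}. real (left_jumps a t x))"
    by (simp add: sum.reindex)
  finally have "c * real m \<le> (\<Sum>x\<in>int ` {..<m}. real (left_jumps a t x)) + C"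
    using C[of m] by simp
  moreover have "real_of_int (walk a t + 2 * (\<Sum>x\<in>int ` {..<m}. int (left_jumps a t x))) \<le> real_of_int (int t)"
    by (subst of_int_le_iff, rule walk_plus_left_jumps_le) simp
  ultimately show ?thesis by (simp add: m algebra_simps)
qed

text \<open>Passing \<open>x0 \<le> 0\<close> to the left would require a left jump from
  \<open>x0\<close>, which \<open>total_branch a x0 = 0\<close> forbids. So all left jumps occur
  between \<open>x0\<close> and the running maximum, and the excess of time over position is at most
  twice the sum of \<open>total_branch\<close> over these sites.\<close>

lemma walk_lower_bound:
  assumes fin: "\<And>x. total_branch a x < \<infinity>"
    and x0: "x0 \<le> 0" "total_branch a x0 = 0"
    and C: "\<And>n. (\<Sum>x<n. enn2real (total_branch a (int x))) \<le> d * real n + C"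
    and M: "\<And>s. s \<le> t \<Longrightarrow> real_of_int (walk a s) \<le> M" and d: "0 \<le> d" 
  shows "real_of_int (walk a t) \<ge> real t - 2 * (d * (M + 1) + C + (\<Sum>x\<in>{x0..<0}. enn2real (total_branch a x)))"
proof -
  have M0: "0 \<le> M" using M[of 0] by simp
  define m where "m = nat \<lfloor>M\<rfloor>"
  have m: "real m \<le> M" using M0 by (simp add: m_def)
  have ge: "x0 \<le> walk a i" for i
  proof (rule ccontr)
    assume "\<not> x0 \<le> walk a i"
    then have "right_jumps a i (x0 - 1) + 1 = left_jumps a i x0"
      using edge_flow[of a i "x0 - 1"] x0(1) by simp
    then show False using left_jumps_le_total_branch[OF fin, of i x0] x0(2) by (simp flip: of_nat_Suc)
  qed
  have le: "walk a i \<le> int m" if "i < t" for i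
    using M[of i] that M0 by (simp add: m_def le_floor_iff)
  have L: "real (left_jumps a t x) \<le> enn2real (total_branch a x)" for x
    using left_jumps_le_total_branch[OF fin, of t x] fin[of x]
    by (cases "total_branch a x") (auto simp: ennreal_of_nat_eq_real_of_nat)
  have split: "{x0..int m} = {x0..<0} \<union> int ` {..<Suc m}"
  proof -
    have "int ` {..<Suc m} = {0..int m}"
      by (auto simp: image_iff intro!: bexI[of _ "nat _"])
    then show ?thesis using x0(1) by auto
  qed
  have "walk a t + 2 * (\<Sum>x\<in>{x0..int m}. int (left_jumps a t x)) = int t"
    using ge le by (intro walk_plus_left_jumps) auto
  then have "real_of_int (walk a t) + 2 * (\<Sum>x\<in>{x0..int m}. real (left_jumps a t x)) = real t"
    by (metis (mono_tags, lifting) of_int_add of_int_mult of_int_numeral of_int_of_nat_eq of_int_sum sum.cong)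
  moreover have "(\<Sum>x\<in>{x0..int m}. real (left_jumps a t x)) \<le> (\<Sum>x\<in>{x0..int m}. enn2real (total_branch a x))"
    by (intro sum_mono L)
  moreover have "(\<Sum>x\<in>{x0..int m}. enn2real (total_branch a x))
     = (\<Sum>x\<in>{x0..<0}. enn2real (total_branch a x)) + (\<Sum>x<Suc m. enn2real (total_branch a (int x)))"
    unfolding split by (subst sum.union_disjoint) (auto simp: sum.reindex simp del: lessThan_Suc sum.lessThan_Suc)
  moreover have "(\<Sum>x<Suc m. enn2real (total_branch a (int x))) \<le> d * (M + 1) + C"
  proof -
    have "d * real (Suc m) \<le> d * (M + 1)" using m d by (intro mult_left_mono) auto
    then show ?thesis using C[of "Suc m"] by simp
  qed
  ultimately show ?thesis by (simp add: algebra_simps)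
qed


subsection \<open>Measure-preserving ergodic maps\<close>

locale ergodic_map = prob_space M for M :: "'a measure" +
  fixes T :: "'a \<Rightarrow> 'a"
  assumes T_measurable [measurable]: "T \<in> measurable M M"
    and T_preserving: "distr M M T = M"
    and T_ergodic: "\<And>A. A \<in> sets M \<Longrightarrow> T -` A \<inter> space M = A \<Longrightarrow> emeasure M A = 0 \<or> emeasure M A = 1"
begin

lemma funpow_T_measurable [measurable]: "(T ^^ n) \<in> measurable M M"
  by (induction n) (auto intro: measurable_comp)

lemma integral_T:
  fixes f :: "'a \<Rightarrow> real"
  assumes "f \<in> borel_measurable M"
  shows "(\<integral>x. f (T x) \<partial>M) = (\<integral>x. f x \<partial>M)"
  using assms by (metis T_measurable T_preserving integral_distr)

lemma integrable_T:
  fixes f :: "'a \<Rightarrow> real"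
  assumes "integrable M f"
  shows "integrable M (\<lambda>x. f (T x))"
  using assms by (metis T_measurable T_preserving integrable_distr)

lemma AE_T: "AE x in M. P x \<Longrightarrow> AE x in M. P (T x)"
  using AE_distrD[OF T_measurable, of P] unfolding T_preserving by blast

lemma AE_funpow_T: "AE x in M. P x \<Longrightarrow> AE x in M. P ((T ^^ n) x)"
proof (induction n)
  case (Suc n)
  have "AE x in M. P ((T ^^ n) (T x))" by (rule AE_T) (use Suc in auto)
  then show ?case by (simp add: funpow_Suc_right del: funpow.simps)
qed simp

text \<open>On the invariant set where the partial sums of \<open>h\<close> are unbounded above, the increments
  \<open>H (N + 1) - H N \<circ> T\<close> of the running maxima have nonnegative integral and
  decrease to \<open>h\<close>; so this set cannot have measure one if \<open>h\<close> has negative mean.\<close>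

theorem AE_bounded_ergodic_sums:
  fixes h :: "'a \<Rightarrow> real"
  assumes h: "integrable M h" and neg: "(\<integral>x. h x \<partial>M) < 0"
  shows "AE x in M. \<exists>C. \<forall>n. (\<Sum>i<n. h ((T ^^ i) x)) \<le> C"
proof -
  define S where "S n x = (\<Sum>i<n. h ((T ^^ i) x))" for n x
  have [measurable]: "h \<in> borel_measurable M" using h by auto
  have [measurable]: "S n \<in> borel_measurable M" for n unfolding S_def by measurable
  have S_Suc: "S (Suc n) x = h x + S n (T x)" for n x
    unfolding S_def by (subst sum.lessThan_Suc_shift) (simp add: funpow_Suc_right del: funpow.simps)
  \<comment> \<open>\<open>H n x\<close> is the maximum of \<open>S m x\<close> over
    \<open>m \<le> n\<close>, given by a recursion so that integrability and monotonicity follow by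
    induction.\<close>
  define H where "H = rec_nat (\<lambda>_. 0) (\<lambda>_ g x. max 0 (h x + g (T x)))"
  have H_simps: "H 0 = (\<lambda>_. 0)" "H (Suc n) = (\<lambda>x. max 0 (h x + H n (T x)))" for n
    by (simp_all add: H_def)
  have H_int: "integrable M (H n)" for n
    by (induction n) (auto simp: H_simps intro!: integrable_max integrable_T h Bochner_Integration.integrable_add)
  have [measurable]: "H n \<in> borel_measurable M" for n using H_int[of n] by auto
  have H_Suc: "H n x \<le> H (Suc n) x" for n x
  proof (induction n arbitrary: x)
    case (Suc n)
    have "max 0 (h x + H n (T x)) \<le> max 0 (h x + H (Suc n) (T x))"
      by (intro max.mono add_left_mono Suc order_refl)
    then show ?case by (simp only: H_simps)
  qed (simp add: H_simps)
  have H_nonneg: "0 \<le> H n x" for n x by (cases n) (auto simp: H_simps)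
  have S_le_H: "S n x \<le> H n x" for n x
  proof (induction n arbitrary: x)
    case (Suc n)
    show ?case using Suc[of "T x"] by (auto simp: S_Suc H_simps)
  qed (simp add: S_def H_simps)
  have H_mono: "m \<le> n \<Longrightarrow> H m x \<le> H n x" for m n x
    by (rule lift_Suc_mono_le[of "\<lambda>n. H n x"]) (auto intro: H_Suc)
  define B where "B = {x\<in>space M. \<forall>c::nat. \<exists>n. real c < S n x}"
  have B_sets [measurable]: "B \<in> sets M" unfolding B_def by measurable
  have shift_unbounded: "(\<forall>c::nat. \<exists>n. real c < S n (T x)) \<longleftrightarrow> (\<forall>c::nat. \<exists>n. real c < S n x)" for x
  proof safe
    fix c :: nat assume *: "\<forall>c::nat. \<exists>n. real c < S n (T x)"
    obtain d :: nat where d: "real c - h x < real d" using reals_Archimedean2 by blast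
    obtain n where "real d < S n (T x)" using * by blast
    then have "real c < S (Suc n) x" using d by (simp add: S_Suc)
    then show "\<exists>n. real c < S n x" by blast
  next
    fix c :: nat assume *: "\<forall>c::nat. \<exists>n. real c < S n x"
    obtain d :: nat where d: "real c + \<bar>h x\<bar> < real d" using reals_Archimedean2 by blast
    obtain n where n: "real d < S n x" using * by blast
    then have "n \<noteq> 0" using d by (cases n) (auto simp: S_def)
    then obtain n' where "n = Suc n'" using not0_implies_Suc by blast
    then have "real c < S n' (T x)" using d n by (simp add: S_Suc)
    then show "\<exists>n. real c < S n (T x)" by blast
  qed
  have "T -` B \<inter> space M = B"
    using shift_unbounded measurable_space[OF T_measurable] by (auto simp: B_def)
  moreover from this have ind_T: "indicator B (T x) = (indicator B x :: real)" if "x \<in> space M" for x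
    using that by (auto simp: indicator_def)
  moreover have "emeasure M B \<noteq> 1"
  proof
    assume "emeasure M B = 1"
    then have AE_B: "AE x in M. x \<in> B"
      by (simp add: AE_in_set_eq_1 measure_def)
    \<comment> \<open>On \<open>B\<close> this is \<open>max (- H n (T x)) (h x)\<close>. It is
      bounded by \<open>\<bar>h x\<bar>\<close> and equals \<open>h x\<close> as soon as
      \<open>H n (T x)\<close> reaches \<open>\<bar>h x\<bar>\<close>, which happens because the
      sums are unbounded there.\<close>
    define D where "D n x = (H (Suc n) x - H n (T x)) * indicator B x" for n x
    have D_nonneg: "0 \<le> (\<integral>x. D n x \<partial>M)" for n
    proof -
      have int: "integrable M (\<lambda>x. H n x * indicator B x)" for n
        by (rule integrable_real_mult_indicator[OF B_sets H_int])
      have "(\<integral>x. D n x \<partial>M) = (\<integral>x. H (Suc n) x * indicator B x - H n (T x) * indicator B (T x) \<partial>M)"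
        by (rule Bochner_Integration.integral_cong) (auto simp: D_def ind_T algebra_simps)
      also have "\<dots> = (\<integral>x. H (Suc n) x * indicator B x \<partial>M) - (\<integral>x. H n (T x) * indicator B (T x) \<partial>M)"
        by (intro Bochner_Integration.integral_diff int integrable_T[OF int])
      also have "(\<integral>x. H n (T x) * indicator B (T x) \<partial>M) = (\<integral>x. H n x * indicator B x \<partial>M)"
        by (rule integral_T) measurable
      finally have "(\<integral>x. D n x \<partial>M)
          = (\<integral>x. H (Suc n) x * indicator B x \<partial>M) - (\<integral>x. H n x * indicator B x \<partial>M)" .
      moreover have "(\<integral>x. H n x * indicator B x \<partial>M) \<le> (\<integral>x. H (Suc n) x * indicator B x \<partial>M)"
        by (intro integral_mono int mult_right_mono H_Suc) auto
      ultimately show ?thesis by simp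
    qed
    have "(\<lambda>n. \<integral>x. D n x \<partial>M) \<longlonglongrightarrow> (\<integral>x. h x * indicator B x \<partial>M)"
    proof (rule integral_dominated_convergence[where w = "\<lambda>x. \<bar>h x\<bar>"])
      show "AE x in M. (\<lambda>n. D n x) \<longlonglongrightarrow> h x * indicator B x"
      proof (rule AE_I2)
        fix x assume x: "x \<in> space M"
        show "(\<lambda>n. D n x) \<longlonglongrightarrow> h x * indicator B x"
        proof (cases "x \<in> B")
          case True
          obtain c :: nat where c: "\<bar>h x\<bar> < real c" using reals_Archimedean2 by blast
          have "\<forall>c::nat. \<exists>n. real c < S n (T x)" using True by (simp add: B_def shift_unbounded)
          then obtain m where "real c < S m (T x)" by blast
          then have "\<bar>h x\<bar> \<le> H n (T x)" if "m \<le> n" for n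
            using S_le_H[of m "T x"] H_mono[OF that, of "T x"] c by linarith
          then have "eventually (\<lambda>n. D n x = h x * indicator B x) sequentially"
            using True by (auto simp: eventually_sequentially D_def H_simps intro!: exI[of _ m]) force+
          then show ?thesis by (rule tendsto_eventually)
        qed (simp add: D_def)
      qed
      show "AE x in M. norm (D n x) \<le> \<bar>h x\<bar>" for n
        using H_nonneg by (intro AE_I2) (auto simp: D_def H_simps indicator_def max_def abs_if, (smt (verit))+)
    qed (use h in \<open>auto simp: D_def intro!: borel_measurable_times\<close>)
    then have "0 \<le> (\<integral>x. h x * indicator B x \<partial>M)"
      by (rule LIMSEQ_le_const) (use D_nonneg in auto)
    also have "\<dots> = (\<integral>x. h x \<partial>M)"
      by (rule integral_cong_AE) (use AE_B in auto)
    finally show False using neg by simp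
  qed
  ultimately have "emeasure M B = 0" using T_ergodic[OF B_sets] by blast
  then have "AE x in M. x \<notin> B" using B_sets by (intro AE_not_in null_setsI)
  with AE_space show ?thesis
  proof eventually_elim
    case (elim x)
    then obtain c :: nat where "\<And>n. S n x \<le> real c" by (auto simp: B_def not_less)
    then show ?case unfolding S_def by blast
  qed
qed

end


subsection \<open>Stationary ergodic arrow fields\<close>

lemma eventually_div_less:
  fixes f :: "nat \<Rightarrow> real"
  assumes "\<And>n. f n \<le> u * real n + C" "u < a"
  shows "eventually (\<lambda>n. f n / real n < a) sequentially"
proof -
  have "(\<lambda>n. u + C / real n) \<longlonglongrightarrow> u + 0"
    by (intro tendsto_intros lim_const_over_n)
  then have "eventually (\<lambda>n. u + C / real n < a) sequentially"
    using assms(2) by (intro order_tendstoD) auto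
  with eventually_gt_at_top[of 0] show ?thesis
  proof eventually_elim
    case (elim n)
    have "f n / real n \<le> (u * real n + C) / real n"
      by (intro divide_right_mono assms) simp
    also have "\<dots> = u + C / real n" using elim by (simp add: add_divide_distrib)
    finally show ?case using elim by simp
  qed
qed

lemma eventually_div_greater:
  fixes f :: "nat \<Rightarrow> real"
  assumes "\<And>n. u * real n - C \<le> f n" "a < u"
  shows "eventually (\<lambda>n. a < f n / real n) sequentially"
proof -
  have "- f n \<le> - u * real n + C" for n using assms(1)[of n] by simp
  from eventually_div_less[of "\<lambda>n. - f n", OF this, of "- a"] assms(2) show ?thesis by simp
qed

context
  fixes M :: "'a measure" and A :: "'a \<Rightarrow> int \<Rightarrow> nat \<Rightarrow> bool"
  assumes A_measurable [measurable]: "\<And>x k. Measurable.pred M (\<lambda>s. A s x k)"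
begin

lemma rights_measurable [measurable]: "(\<lambda>s. rights (A s x) n) \<in> measurable M (count_space UNIV)"
  by (induction n) (simp_all add: of_bool_def)

lemma lefts_measurable [measurable]: "(\<lambda>s. lefts (A s x) n) \<in> measurable M (count_space UNIV)"
  by (induction n) (simp_all add: of_bool_def)

lemma branch_measurable: "(\<lambda>s. branch k (A s) x) \<in> borel_measurable M"
proof (induction k arbitrary: x)
  case (Suc k)
  note [measurable] = Suc
  show ?case unfolding branch.simps offspring_def by measurable
qed simp

lemma total_branch_measurable: "(\<lambda>s. total_branch (A s) x) \<in> borel_measurable M"
  unfolding total_branch_def using branch_measurable by measurable

end

text \<open>The last assumption is the abstract form in which ellipticity enters. The inverse
  \<open>T'\<close> gives access to the sites left of \<open>0\<close>, and exchanging
  \<open>T\<close> and \<open>T'\<close> makes the locale applicable to the mirrored field.\<close>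

locale arrow_system = ergodic_map M T for M :: "'a measure" and T +
  fixes T' :: "'a \<Rightarrow> 'a" and A :: "'a \<Rightarrow> int \<Rightarrow> nat \<Rightarrow> bool"
  assumes T'_measurable [measurable]: "T' \<in> measurable M M"
    and T'_T: "\<And>s. s \<in> space M \<Longrightarrow> T' (T s) = s"
    and T_T': "\<And>s. s \<in> space M \<Longrightarrow> T (T' s) = s"
    and A_measurable [measurable]: "\<And>x k. Measurable.pred M (\<lambda>s. A s x k)"
    and A_T: "\<And>s x. s \<in> space M \<Longrightarrow> A (T s) x = A s (x + 1)"
    and total_branch_zero:
      "(AE s in M. total_branch (A s) 1 < \<infinity>) \<Longrightarrow> \<not> (AE s in M. total_branch (A s) 0 \<noteq> 0)"
begin

lemma T_in_space: "s \<in> space M \<Longrightarrow> T s \<in> space M"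
  by (rule measurable_space[OF T_measurable])

lemma T'_in_space: "s \<in> space M \<Longrightarrow> T' s \<in> space M"
  by (rule measurable_space[OF T'_measurable])

text \<open>\<open>T\<close> and \<open>T'\<close> have the same invariant sets, and pushing
  \<open>M\<close> forward by \<open>T\<close> and then by \<open>T'\<close> gives back
  \<open>M\<close>.\<close>

lemma ergodic_map_inverse: "ergodic_map M T'"
proof
  show "distr M M T' = M"
  proof -
    have "distr M M T' = distr (distr M M T) M T'" by (simp add: T_preserving)
    also have "\<dots> = distr M M (T' \<circ> T)" by (rule distr_distr) auto
    also have "\<dots> = distr M M (\<lambda>x. x)" by (rule distr_cong) (auto simp: T'_T)
    finally show ?thesis by (simp add: distr_id2)
  qed
  fix B assume B: "B \<in> sets M" "T' -` B \<inter> space M = B"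
  then have "T' s \<in> B \<longleftrightarrow> s \<in> B" if "s \<in> space M" for s using that by blast
  then have "T -` B \<inter> space M = B"
    using sets.sets_into_space[OF B(1)] by (auto simp: T_in_space) (metis T'_T T_in_space subsetD)+
  then show "emeasure M B = 0 \<or> emeasure M B = 1" using T_ergodic B by blast
qed simp

sublocale inverse: ergodic_map M T'
  by (rule ergodic_map_inverse)

lemma A_T': "s \<in> space M \<Longrightarrow> A (T' s) x = A s (x - 1)"
  using A_T[of "T' s" "x - 1"] by (simp add: T'_in_space T_T')

lemma funpow_T_in_space: "s \<in> space M \<Longrightarrow> (T ^^ n) s \<in> space M"
  by (induction n) (auto simp: T_in_space)

lemma funpow_T'_in_space: "s \<in> space M \<Longrightarrow> (T' ^^ n) s \<in> space M"
  by (induction n) (auto simp: T'_in_space)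

lemma A_funpow_T: "s \<in> space M \<Longrightarrow> A ((T ^^ n) s) = (\<lambda>x. A s (x + int n))"
  by (induction n) (auto simp: A_T funpow_T_in_space ac_simps)

lemma A_funpow_T': "s \<in> space M \<Longrightarrow> A ((T' ^^ n) s) = (\<lambda>x. A s (x + (- int n)))"
  by (induction n) (auto simp: A_T' funpow_T'_in_space algebra_simps)

lemma branch_funpow_T: "s \<in> space M \<Longrightarrow> branch k (A ((T ^^ n) s)) 0 = branch k (A s) (int n)"
  using branch_translate[of k "A s" "int n" 0] by (simp add: A_funpow_T)

lemma total_branch_funpow_T: "s \<in> space M \<Longrightarrow> total_branch (A ((T ^^ n) s)) 0 = total_branch (A s) (int n)"
  by (simp add: total_branch_def branch_funpow_T)

lemma total_branch_funpow_T': "s \<in> space M \<Longrightarrow> total_branch (A ((T' ^^ n) s)) 0 = total_branch (A s) (- int n)"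
  using total_branch_translate[of "A s" "- int n" 0] by (simp only: A_funpow_T') simp

lemmas [measurable] = branch_measurable[OF A_measurable] total_branch_measurable[OF A_measurable]

section \<open>Almost sure linear bounds and the speed\<close>

definition mean_branch :: ennreal where
  "mean_branch = (\<integral>\<^sup>+s. total_branch (A s) 0 \<partial>M)"

text \<open>For \<open>c\<close> below the mean, some truncation \<open>g\<close> of the branching
  value still has mean above \<open>c\<close>, so the ergodic sums of \<open>c - g\<close> are
  bounded above and \<open>walk_upper_bound\<close> applies. The alternative \<open>c = 0\<close>
  covers a vanishing mean.\<close>

lemma AE_walk_upper:
  assumes c: "0 \<le> c" "c = 0 \<or> ennreal c < mean_branch"
  shows "AE s in M. \<exists>C. \<forall>t. real_of_int (walk (A s) t) * (1 + 2 * c) \<le> real t + C"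
proof (cases "c = 0")
  case True
  have "real_of_int (walk (A s) t) \<le> real t" for s t using walk_abs_le[of "A s" t] by linarith
  then show ?thesis using True by (intro AE_I2 exI[of _ 0]) simp
next
  case False
  \<comment> \<open>Cutting both depth and value keeps \<open>b k\<close> integrable even if
    \<open>mean_branch\<close> is infinite, while the supremum over \<open>k\<close> is still
    \<open>total_branch (A s) 0\<close>.\<close>
  define b where "b k s = min (branch k (A s) 0) (of_nat k)" for k s
  have [measurable]: "b k \<in> borel_measurable M" for k unfolding b_def by measurable
  have inc: "incseq b"
    unfolding b_def by (intro incseq_SucI le_funI min.mono branch_le_Suc) simp
  have "total_branch (A s) 0 = (SUP k. b k s)" for s
  proof (rule antisym)
    show "(SUP k. b k s) \<le> total_branch (A s) 0"
      by (rule SUP_least) (auto simp: b_def intro: min.coboundedI1 branch_le_total)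
    show "total_branch (A s) 0 \<le> (SUP k. b k s)"
      unfolding total_branch_def
    proof (rule SUP_least)
      fix k
      show "branch k (A s) 0 \<le> (SUP k. b k s)"
      proof (rule dense_le)
        fix y assume y: "y < branch k (A s) 0"
        then obtain m where m: "y \<le> of_nat m"
          by (metis ennreal_Ex_less_of_nat le_less less_le_trans top_greatest)
        have "y \<le> b (max k m) s"
          using y m incseqD[OF incseq_branch, of k "max k m" "A s" 0]
          by (auto simp: b_def intro: order_trans[of y "of_nat m"])
        also have "\<dots> \<le> (SUP k. b k s)" by (rule SUP_upper) simp
        finally show "y \<le> (SUP k. b k s)" .
      qed
    qed
  qed
  then have "mean_branch = (SUP k. \<integral>\<^sup>+s. b k s \<partial>M)"
    unfolding mean_branch_def using inc by (simp add: nn_integral_monotone_convergence_SUP)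
  then obtain k where k: "ennreal c < (\<integral>\<^sup>+s. b k s \<partial>M)"
    using c False by (auto simp: less_SUP_iff)
  define g where "g s = enn2real (b k s)" for s
  have b_fin: "b k s < top" for s
    unfolding b_def by (rule le_less_trans[OF min.cobounded2]) (simp add: of_nat_less_top)
  have g: "ennreal (g s) = b k s" for s using b_fin by (simp add: g_def)
  have [measurable]: "g \<in> borel_measurable M" unfolding g_def by measurable
  have g_le: "g s \<le> real k" for s
  proof -
    have "ennreal (g s) \<le> of_nat k" unfolding g b_def by simp
    then show ?thesis by (simp add: ennreal_of_nat_eq_real_of_nat)
  qed
  have int_g: "integrable M g"
    by (rule integrable_const_bound[of _ "real k"]) (use g_le in \<open>auto simp: g_def\<close>)
  have "ennreal c < ennreal (\<integral>s. g s \<partial>M)"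
    using k int_g by (subst nn_integral_eq_integral[symmetric]) (auto simp: g, simp add: g_def)
  then have "(\<integral>s. c - g s \<partial>M) < 0"
    using int_g c by (simp add: ennreal_less_iff prob_space)
  then have "AE s in M. \<exists>C. \<forall>n. (\<Sum>i<n. c - g ((T ^^ i) s)) \<le> C"
    using int_g by (intro AE_bounded_ergodic_sums) auto
  with AE_space show ?thesis
  proof eventually_elim
    case (elim s)
    then obtain C where C: "\<And>n. (\<Sum>i<n. c - g ((T ^^ i) s)) \<le> C" by blast
    have "real_of_int (walk (A s) t) * (1 + 2 * c) \<le> real t + 2 * (C + c * real k)" for t
    proof (rule walk_upper_bound[where g = "\<lambda>i. g ((T ^^ i) s)"])
      show "ennreal (g ((T ^^ i) s)) \<le> branch k (A s) (int i)" for i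
        unfolding g b_def using elim by (simp add: branch_funpow_T)
      show "c * real n \<le> (\<Sum>i<n. g ((T ^^ i) s)) + C" for n
        using C[of n] by (simp add: sum_subtractf mult.commute)
      show "0 \<le> C" using C[of 0] by simp
    qed (use c in \<open>auto simp: g_def\<close>)
    then show ?case by blast
  qed
qed

lemma AE_total_branch_finite:
  assumes "mean_branch < \<infinity>"
  shows "AE s in M. \<forall>x. total_branch (A s) x < \<infinity>"
proof -
  have fin: "AE s in M. total_branch (A s) 0 < \<infinity>"
    using nn_integral_PInf_AE[of "\<lambda>s. total_branch (A s) 0" M] assms
    by (auto simp: mean_branch_def less_top)
  have 1: "AE s in M. \<forall>n. total_branch (A s) (int n) < \<infinity>"
    unfolding AE_all_countable
  proof
    fix n
    from AE_space AE_funpow_T[OF fin, of n] show "AE s in M. total_branch (A s) (int n) < \<infinity>"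
      by eventually_elim (simp add: total_branch_funpow_T)
  qed
  have 2: "AE s in M. \<forall>n. total_branch (A s) (- int n) < \<infinity>"
    unfolding AE_all_countable
  proof
    fix n
    from AE_space inverse.AE_funpow_T[OF fin, of n] show "AE s in M. total_branch (A s) (- int n) < \<infinity>"
      by eventually_elim (simp add: total_branch_funpow_T')
  qed
  from 1 2 show ?thesis
  proof eventually_elim
    case (elim s)
    show ?case
    proof
      fix x show "total_branch (A s) x < \<infinity>"
        using elim by (cases x rule: int_cases2) auto
    qed
  qed
qed

text \<open>A zero at the origin has probability \<open>p > 0\<close>. The backward ergodic sums of
  \<open>p / 2 - indicator Z\<close> have negative mean and so are bounded above, whereas without a
  zero at any \<open>x \<le> 0\<close> they would grow like \<open>n * p / 2\<close>.\<close>

lemma AE_total_branch_zero: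
  assumes "mean_branch < \<infinity>"
  shows "AE s in M. \<exists>x\<le>0. total_branch (A s) x = 0"
proof -
  define Z where "Z = {s\<in>space M. total_branch (A s) 0 = 0}"
  have Z [measurable]: "Z \<in> sets M" unfolding Z_def by measurable
  define p where "p = measure M Z"
  have "AE s in M. total_branch (A s) 1 < \<infinity>"
    using AE_total_branch_finite[OF assms] by eventually_elim blast
  then have "\<not> (AE s in M. total_branch (A s) 0 \<noteq> 0)" by (rule total_branch_zero)
  moreover have "AE s in M. total_branch (A s) 0 \<noteq> 0" if "p = 0"
  proof -
    have "Z \<in> null_sets M" using that Z by (auto simp: p_def emeasure_eq_measure)
    from AE_not_in[OF this] AE_space show ?thesis by eventually_elim (auto simp: Z_def)
  qed
  ultimately have "p \<noteq> 0" by blast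
  then have p: "0 < p" by (simp add: p_def zero_less_measure_iff)
  have "(\<integral>s. p / 2 - indicator Z s \<partial>M) = p / 2 - p"
    by (subst Bochner_Integration.integral_diff) (auto simp: prob_space p_def emeasure_eq_measure)
  then have "(\<integral>s. p / 2 - indicator Z s \<partial>M) < 0" using p by simp
  then have "AE s in M. \<exists>C. \<forall>n. (\<Sum>i<n. p / 2 - indicator Z ((T' ^^ i) s)) \<le> C"
    by (intro inverse.AE_bounded_ergodic_sums Bochner_Integration.integrable_diff) (auto simp: emeasure_eq_measure)
  with AE_space show ?thesis
  proof eventually_elim
    case (elim s)
    then obtain C where C: "\<And>n. (\<Sum>i<n. p / 2 - indicator Z ((T' ^^ i) s)) \<le> C" by blast
    show ?case
    proof (rule ccontr)
      assume "\<not> ?thesis"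
      then have "(T' ^^ i) s \<notin> Z" for i
        using elim by (auto simp: Z_def total_branch_funpow_T')
      then have bound: "real n * (p / 2) \<le> C" for n using C[of n] by simp
      obtain n where "C < real n * (p / 2)" using reals_Archimedean3[of "p / 2"] p by auto
      with bound[of n] show False by simp
    qed
  qed
qed

text \<open>The upper bound with \<open>c\<close> controls the running maximum up to time
  \<open>t\<close>, and \<open>d\<close> bounds the growth of the sums of
  \<open>total_branch\<close> up to that maximum. As \<open>c\<close> and \<open>d\<close> approach
  the mean \<open>E\<close>, the slope tends to \<open>1 / (1 + 2 * E)\<close>.\<close>

lemma AE_walk_lower:
  assumes fin: "mean_branch < \<infinity>" and c: "0 \<le> c" "c = 0 \<or> ennreal c < mean_branch"
    and d: "enn2real mean_branch < d"
  shows "AE s in M. \<exists>C. \<forall>t. (1 - 2 * d / (1 + 2 * c)) * real t - C \<le> real_of_int (walk (A s) t)"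
proof -
  define h where "h s = enn2real (total_branch (A s) 0)" for s
  have [measurable]: "h \<in> borel_measurable M" unfolding h_def by measurable
  have nn: "(\<integral>\<^sup>+s. ennreal (h s) \<partial>M) = mean_branch"
    unfolding mean_branch_def
  proof (rule nn_integral_cong_AE)
    show "AE s in M. ennreal (h s) = total_branch (A s) 0"
      using AE_total_branch_finite[OF fin] by eventually_elim (simp add: h_def)
  qed
  have int_h: "integrable M h"
    by (rule integrableI_nonneg) (use nn fin in \<open>auto simp: h_def\<close>)
  have "(\<integral>s. h s \<partial>M) = enn2real mean_branch"
    using nn by (subst integral_eq_nn_integral) (auto simp: h_def)
  then have "(\<integral>s. h s - d \<partial>M) < 0"
    using int_h d by (simp add: prob_space)
  then have "AE s in M. \<exists>C. \<forall>n. (\<Sum>i<n. h ((T ^^ i) s) - d) \<le> C"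
    using int_h by (intro AE_bounded_ergodic_sums) auto
  with AE_space AE_total_branch_finite[OF fin] AE_total_branch_zero[OF fin] AE_walk_upper[OF c]
  show ?thesis
  proof eventually_elim
    case (elim s)
    obtain C where C: "\<And>n. (\<Sum>i<n. h ((T ^^ i) s) - d) \<le> C" using elim by blast
    obtain x0 where x0: "x0 \<le> 0" "total_branch (A s) x0 = 0" using elim by blast
    obtain B where B: "\<And>t. real_of_int (walk (A s) t) * (1 + 2 * c) \<le> real t + B" using elim by blast
    have d0: "0 \<le> d" using d enn2real_nonneg[of mean_branch] by linarith
    define K where "K = 2 * (d * (B / (1 + 2 * c) + 1) + C + (\<Sum>x\<in>{x0..<0}. enn2real (total_branch (A s) x)))"
    have "(1 - 2 * d / (1 + 2 * c)) * real t - K \<le> real_of_int (walk (A s) t)" for t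
    proof -
      have "real t - 2 * (d * ((real t + B) / (1 + 2 * c) + 1) + C + (\<Sum>x\<in>{x0..<0}. enn2real (total_branch (A s) x)))
          \<le> real_of_int (walk (A s) t)"
      proof (rule walk_lower_bound[OF _ x0])
        show "total_branch (A s) x < \<infinity>" for x using elim by blast
        show "(\<Sum>x<n. enn2real (total_branch (A s) (int x))) \<le> d * real n + C" for n
          using C[of n] elim by (simp add: sum_subtractf mult.commute h_def total_branch_funpow_T)
        \<comment> \<open>Relaxing the earlier time \<open>i\<close> to \<open>t\<close> turns the
          pointwise bound into one for the running maximum.\<close>
        show "real_of_int (walk (A s) i) \<le> (real t + B) / (1 + 2 * c)" if "i \<le> t" for i
          using B[of i] that c by (simp add: pos_le_divide_eq)
      qed (fact d0)
      then show ?thesis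
        by (simp add: K_def algebra_simps add_divide_distrib)
    qed
    then show ?case by blast
  qed
qed

text \<open>Countably many values \<open>c j\<close> and \<open>d j\<close> approach the mean from
  below and above, so one null set serves for all the linear bounds.\<close>

lemma AE_walk_speed:
  assumes fin: "mean_branch < \<infinity>"
  shows "AE s in M. (\<lambda>t. real_of_int (walk (A s) t) / real t) \<longlonglongrightarrow> 1 / (1 + 2 * enn2real mean_branch)"
proof -
  define e where "e = enn2real mean_branch"
  have e0: "0 \<le> e" by (simp add: e_def)
  define c where "c j = max 0 (e - inverse (real (Suc j)))" for j
  define d where "d j = e + inverse (real (Suc j))" for j
  have c: "0 \<le> c j" "c j = 0 \<or> ennreal (c j) < mean_branch" for j
  proof -
    have "ennreal (c j) < ennreal e" if "c j \<noteq> 0"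
      using that by (auto simp: c_def max_def ennreal_less_iff split: if_splits)
    then show "0 \<le> c j" "c j = 0 \<or> ennreal (c j) < mean_branch"
      using fin by (auto simp: c_def e_def)
  qed
  have d: "enn2real mean_branch < d j" for j by (simp add: d_def e_def)
  have "c \<longlonglongrightarrow> max 0 (e - 0)"
    unfolding c_def by (intro tendsto_max tendsto_diff tendsto_const LIMSEQ_inverse_real_of_nat)
  then have lim_c: "c \<longlonglongrightarrow> e" using e0 by (simp add: max_def)
  have "d \<longlonglongrightarrow> e + 0"
    unfolding d_def by (intro tendsto_add tendsto_const LIMSEQ_inverse_real_of_nat)
  then have lim_d: "d \<longlonglongrightarrow> e" by simp
  have lim_u: "(\<lambda>j. 1 / (1 + 2 * c j)) \<longlonglongrightarrow> 1 / (1 + 2 * e)"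
    using e0 by (intro tendsto_intros lim_c) auto
  have "(\<lambda>j. 1 - 2 * d j / (1 + 2 * c j)) \<longlonglongrightarrow> 1 - 2 * e / (1 + 2 * e)"
    using e0 by (intro tendsto_intros lim_c lim_d) auto
  moreover have "1 - 2 * e / (1 + 2 * e) = 1 / (1 + 2 * e)" using e0 by (simp add: field_simps)
  ultimately have lim_l: "(\<lambda>j. 1 - 2 * d j / (1 + 2 * c j)) \<longlonglongrightarrow> 1 / (1 + 2 * e)" by simp
  have "AE s in M. \<forall>j. \<exists>C. \<forall>t. real_of_int (walk (A s) t) * (1 + 2 * c j) \<le> real t + C"
    unfolding AE_all_countable using AE_walk_upper[OF c] by blast
  moreover have "AE s in M. \<forall>j. \<exists>C. \<forall>t. (1 - 2 * d j / (1 + 2 * c j)) * real t - C \<le> real_of_int (walk (A s) t)"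
    unfolding AE_all_countable using AE_walk_lower[OF fin c d] by blast
  ultimately show ?thesis
  proof eventually_elim
    case (elim s)
    show ?case
    proof (rule order_tendstoI)
      fix a assume "1 / (1 + 2 * enn2real mean_branch) < a"
      then have "eventually (\<lambda>j. 1 / (1 + 2 * c j) < a) sequentially"
        using lim_u by (intro order_tendstoD) (auto simp: e_def)
      then obtain j where j: "1 / (1 + 2 * c j) < a" by (meson eventually_happens' sequentially_bot)
      obtain C where C: "\<And>t. real_of_int (walk (A s) t) * (1 + 2 * c j) \<le> real t + C"
        using elim(1) by blast
      show "eventually (\<lambda>t. real_of_int (walk (A s) t) / real t < a) sequentially"
      proof (rule eventually_div_less[OF _ j])
        fix t show "real_of_int (walk (A s) t) \<le> 1 / (1 + 2 * c j) * real t + C / (1 + 2 * c j)"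
          using C[of t] c(1)[of j] by (simp add: pos_le_divide_eq flip: add_divide_distrib)
      qed
    next
      fix a assume "a < 1 / (1 + 2 * enn2real mean_branch)"
      then have "eventually (\<lambda>j. a < 1 - 2 * d j / (1 + 2 * c j)) sequentially"
        using lim_l by (intro order_tendstoD) (auto simp: e_def)
      then obtain j where j: "a < 1 - 2 * d j / (1 + 2 * c j)" by (meson eventually_happens' sequentially_bot)
      obtain C where C: "\<And>t. (1 - 2 * d j / (1 + 2 * c j)) * real t - C \<le> real_of_int (walk (A s) t)"
        using elim(2) by blast
      show "eventually (\<lambda>t. a < real_of_int (walk (A s) t) / real t) sequentially"
        by (rule eventually_div_greater[OF C j])
    qed
  qed
qed

lemma AE_walk_limsup_zero:
  assumes "mean_branch = \<infinity>"
  shows "AE s in M. \<forall>a>0. eventually (\<lambda>t. real_of_int (walk (A s) t) / real t < a) sequentially"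
proof -
  have "AE s in M. \<forall>j. \<exists>C. \<forall>t. real_of_int (walk (A s) t) * (1 + 2 * real j) \<le> real t + C"
    unfolding AE_all_countable using AE_walk_upper assms by simp
  then show ?thesis
  proof eventually_elim
    case (elim s)
    show ?case
    proof (intro allI impI)
      fix a :: real assume a: "0 < a"
      obtain j :: nat where "1 / a < real j" using reals_Archimedean2 by blast
      then have "1 < a * (1 + 2 * real j)" using a by (simp add: field_simps)
      then have j: "1 / (1 + 2 * real j) < a" by (simp add: field_simps)
      obtain C where C: "\<And>t. real_of_int (walk (A s) t) * (1 + 2 * real j) \<le> real t + C"
        using elim by blast
      show "eventually (\<lambda>t. real_of_int (walk (A s) t) / real t < a) sequentially"
      proof (rule eventually_div_less[OF _ j])
        fix t show "real_of_int (walk (A s) t) \<le> 1 / (1 + 2 * real j) * real t + C / (1 + 2 * real j)"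
          using C[of t] by (simp add: pos_le_divide_eq flip: add_divide_distrib)
      qed
    qed
  qed
qed

end

lemma AE_walk_converges:
  assumes "arrow_system M T T' A" "arrow_system M T' T (\<lambda>s. mirror (A s))"
  shows "\<exists>v. \<bar>v\<bar> \<le> 1 \<and> (AE s in M. (\<lambda>t. real_of_int (walk (A s) t) / real t) \<longlonglongrightarrow> v)"
proof -
  interpret R: arrow_system M T T' A by fact
  interpret L: arrow_system M T' T "\<lambda>s. mirror (A s)" by fact
  have bound: "\<bar>1 / (1 + 2 * enn2real m)\<bar> \<le> 1" for m
  proof -
    have "0 < 1 + 2 * enn2real m" using enn2real_nonneg[of m] by linarith
    then show ?thesis by (simp add: divide_le_eq_1)
  qed
  show ?thesis
  proof (cases "R.mean_branch < \<infinity>")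
    case True
    then show ?thesis using R.AE_walk_speed bound by blast
  next
    case R: False
    show ?thesis
    proof (cases "L.mean_branch < \<infinity>")
      case True
      let ?v = "1 / (1 + 2 * enn2real L.mean_branch)"
      from L.AE_walk_speed[OF True]
      have "AE s in M. (\<lambda>t. real_of_int (walk (A s) t) / real t) \<longlonglongrightarrow> - ?v"
      proof eventually_elim
        case (elim s)
        from tendsto_minus[OF this] show ?case by (simp add: walk_mirror)
      qed
      moreover have "\<bar>- ?v\<bar> \<le> 1" using bound by simp
      ultimately show ?thesis by blast
    next
      case False
      have R': "R.mean_branch = \<infinity>" and L': "L.mean_branch = \<infinity>"
        using R False by (simp_all add: less_top[symmetric])
      have "AE s in M. (\<lambda>t. real_of_int (walk (A s) t) / real t) \<longlonglongrightarrow> 0"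
        using R.AE_walk_limsup_zero[OF R'] L.AE_walk_limsup_zero[OF L']
      proof eventually_elim
        case (elim s)
        show ?case
        proof (rule order_tendstoI)
          fix a :: real assume "a < 0"
          then have "eventually (\<lambda>t. real_of_int (walk (mirror (A s)) t) / real t < - a) sequentially"
            using elim(2) by simp
          then show "eventually (\<lambda>t. a < real_of_int (walk (A s) t) / real t) sequentially"
            by eventually_elim (simp add: walk_mirror)
        qed (use elim(1) in blast)
      qed
      then show ?thesis by (intro exI[of _ 0]) simp
    qed
  qed
qed


subsection \<open>Independent uniform variables\<close>

text \<open>Polymorphic in the index: times for the excited random walk, pairs of site and depth for
  the stacks.\<close>

definition iid_uniform :: "('i \<Rightarrow> real) measure" where
  "iid_uniform = PiM UNIV (\<lambda>_. uniform_measure lborel {0..1::real})"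

lemma prob_space_unit_uniform: "prob_space (uniform_measure lborel {0..1::real})"
  by (rule prob_space_uniform_measure) auto

lemma product_prob_space_unit_uniform: "product_prob_space (\<lambda>_. uniform_measure lborel {0..1::real})"
  by (intro product_prob_spaceI prob_space_unit_uniform)

interpretation iid_uniform: prob_space iid_uniform
  unfolding iid_uniform_def by (intro prob_space_PiM prob_space_unit_uniform)

lemma space_iid_uniform [simp]: "space iid_uniform = UNIV"
  by (simp add: iid_uniform_def space_PiM)

lemma iid_uniform_coordinate [measurable]: "(\<lambda>V. V i) \<in> borel_measurable iid_uniform"
proof -
  have "(\<lambda>V. V i) \<in> measurable iid_uniform (uniform_measure lborel {0..1::real})"
    unfolding iid_uniform_def by measurable
  then show ?thesis by (simp cong: measurable_cong_sets)
qed

lemma measurable_into_iid_uniform: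
  assumes "\<And>i. (\<lambda>x. f x i) \<in> borel_measurable M"
  shows "f \<in> measurable M iid_uniform"
  unfolding iid_uniform_def
proof (rule measurable_PiM_single')
  fix i show "(\<lambda>x. f x i) \<in> measurable M (uniform_measure lborel {0..1})"
    using assms by (simp cong: measurable_cong_sets)
qed simp

lemma emeasure_iid_uniform_cylinder:
  assumes "finite J" "\<And>i. i \<in> J \<Longrightarrow> S i \<in> sets borel"
  shows "emeasure iid_uniform {V. \<forall>i\<in>J. V i \<in> S i} = (\<Prod>i\<in>J. emeasure (uniform_measure lborel {0..1}) (S i))"
proof -
  interpret P: product_prob_space "\<lambda>_. uniform_measure lborel {0..1::real}" UNIV
    by (rule product_prob_space_unit_uniform)
  show ?thesis
    using P.emeasure_PiM_Collect[of J S] assms by (simp add: iid_uniform_def space_PiM)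
qed

lemma distr_iid_uniform_reindex:
  assumes "inj f"
  shows "distr iid_uniform iid_uniform (\<lambda>V i. V (f i)) = iid_uniform"
  using distr_PiM_reindex[of UNIV "\<lambda>_. uniform_measure lborel {0..1::real}" f UNIV] assms
  by (simp add: iid_uniform_def prob_space_unit_uniform restrict_def)

definition determined_by :: "'i set \<Rightarrow> ('i \<Rightarrow> real) set \<Rightarrow> bool" where
  "determined_by J B \<longleftrightarrow> (\<forall>V V'. (\<forall>i\<in>J. V i = V' i) \<longrightarrow> V \<in> B \<longrightarrow> V' \<in> B)"

lemma iid_uniform_indep:
  fixes B C :: "('i \<Rightarrow> real) set"
  assumes B: "B \<in> sets iid_uniform" "C \<in> sets iid_uniform"
    and det: "determined_by J B" "determined_by K C" and disj: "J \<inter> K = {}"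
  shows "measure iid_uniform (B \<inter> C) = measure iid_uniform B * measure iid_uniform C"
proof -
  let ?U = "uniform_measure lborel {0..1::real}"
  have indep: "iid_uniform.indep_vars (\<lambda>_. ?U) (\<lambda>i V. V (i :: 'i)) UNIV"
  proof (subst iid_uniform.indep_vars_iff_distr_eq_PiM)
    have *: "distr iid_uniform ?U (\<lambda>V. V i) = ?U" for i :: 'i
      unfolding iid_uniform_def by (rule distr_PiM_component) (auto intro: prob_space_unit_uniform)
    show "distr iid_uniform (PiM UNIV (\<lambda>_. ?U)) (\<lambda>x. \<lambda>i\<in>UNIV. x (i :: 'i))
        = PiM UNIV (\<lambda>i. distr iid_uniform ?U (\<lambda>V. V i))"
      unfolding * by (simp add: restrict_def iid_uniform_def distr_id2)
  qed (auto cong: measurable_cong_sets)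
  \<comment> \<open>Padding by \<open>0\<close> outside \<open>J\<close> lets an event determined by
    \<open>J\<close> be read off the restriction to \<open>J\<close>. Independence of restrictions
    to disjoint index sets then applies.\<close>
  define ext :: "'i set \<Rightarrow> ('i \<Rightarrow> real) \<Rightarrow> 'i \<Rightarrow> real" where "ext J V i = (if i \<in> J then V i else 0)" for J V i
  have ext_measurable: "ext J \<in> measurable (PiM J (\<lambda>_. ?U)) iid_uniform" for J
  proof (rule measurable_into_iid_uniform)
    fix i
    have "(\<lambda>V. V i) \<in> borel_measurable (PiM J (\<lambda>_. ?U))" if "i \<in> J"
      using measurable_component_singleton[OF that, of "\<lambda>_. ?U"] by (simp cong: measurable_cong_sets)
    then show "(\<lambda>V. ext J V i) \<in> borel_measurable (PiM J (\<lambda>_. ?U))"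
      by (cases "i \<in> J") (simp_all add: ext_def)
  qed
  have ext_iff: "ext J (restrict V J) \<in> B \<longleftrightarrow> V \<in> B" if "determined_by J B" for V J B
    using that unfolding determined_by_def by (auto simp: ext_def) (metis (mono_tags, lifting) ext_def restrict_apply')+
  define Xa where "Xa = ext J -` B \<inter> space (PiM J (\<lambda>_. ?U))"
  define Xb where "Xb = ext K -` C \<inter> space (PiM K (\<lambda>_. ?U))"
  have "Xa \<in> sets (PiM J (\<lambda>_. ?U))" "Xb \<in> sets (PiM K (\<lambda>_. ?U))"
    unfolding Xa_def Xb_def using ext_measurable B by (auto intro: measurable_sets)
  from iid_uniform.indep_varD[OF iid_uniform.indep_var_restrict[OF indep disj] this]
  have "measure iid_uniform {V. restrict V J \<in> Xa \<and> restrict V K \<in> Xb}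
      = measure iid_uniform {V. restrict V J \<in> Xa} * measure iid_uniform {V. restrict V K \<in> Xb}"
    by (simp add: vimage_def)
  moreover have "restrict V J \<in> Xa \<longleftrightarrow> V \<in> B" "restrict V K \<in> Xb \<longleftrightarrow> V \<in> C" for V
    unfolding Xa_def Xb_def using ext_iff det by (auto simp: space_PiM)
  ultimately show ?thesis by (simp add: Int_def)
qed

text \<open>Induction over the generated sigma-algebra. A countable union is first cut to finitely
  many sets, at cost \<open>\<epsilon> / 2\<close>, and these are then approximated one by one with
  total cost at most \<open>\<epsilon> / 2\<close>.\<close>

lemma (in prob_space) approximation_by_algebra:
  assumes G: "G \<subseteq> events" "\<And>B. B \<in> G \<Longrightarrow> space M - B \<in> G"
      "\<And>B C. B \<in> G \<Longrightarrow> C \<in> G \<Longrightarrow> B \<union> C \<in> G" "{} \<in> G"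
    and A: "A \<in> sigma_sets (space M) G" and "0 < \<epsilon>"
  shows "\<exists>B\<in>G. prob ((A - B) \<union> (B - A)) < \<epsilon>"
  using A \<open>0 < \<epsilon>\<close>
proof (induction arbitrary: \<epsilon>)
  case (Basic A)
  then show ?case by (intro bexI[of _ A]) auto
next
  case Empty
  then show ?case using G by (intro bexI[of _ "{}"]) auto
next
  case (Compl A)
  then obtain B where B: "B \<in> G" "prob ((A - B) \<union> (B - A)) < \<epsilon>" by blast
  have "A \<in> events" "B \<in> events" using Compl sigma_sets_into_sp sets.sigma_sets_subset[OF G(1)] B G by auto
  then have "prob (((space M - A) - (space M - B)) \<union> ((space M - B) - (space M - A))) \<le> prob ((A - B) \<union> (B - A))"
    by (intro finite_measure_mono) auto
  then show ?case using B G(2) by (intro bexI[of _ "space M - B"]) auto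
next
  case (Union A)
  have A: "A i \<in> events" for i using Union sets.sigma_sets_subset[OF G(1)] by auto
  have "(\<lambda>n. prob (\<Union>i<n. A i)) \<longlonglongrightarrow> prob (\<Union>n. \<Union>i<n. A i)"
    using A by (intro finite_Lim_measure_incseq) (auto simp: incseq_def, fastforce)
  moreover have "(\<Union>n. \<Union>i<n. A i) = (\<Union>i. A i)" by auto
  ultimately have "eventually (\<lambda>n. prob (\<Union>i. A i) - \<epsilon> / 2 < prob (\<Union>i<n. A i)) sequentially"
    using Union.prems by (intro order_tendstoD) auto
  then obtain n where n: "prob (\<Union>i. A i) - \<epsilon> / 2 < prob (\<Union>i<n. A i)"
    by (meson eventually_happens' sequentially_bot)
  \<comment> \<open>\<open>Suc n\<close> instead of \<open>n\<close> keeps the tolerance positive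
    when the finite union is empty.\<close>
  have "\<forall>i. \<exists>B\<in>G. prob ((A i - B) \<union> (B - A i)) < \<epsilon> / (2 * real (Suc n))"
    using Union by simp
  then obtain B where B: "\<And>i. B i \<in> G" "\<And>i. prob ((A i - B i) \<union> (B i - A i)) < \<epsilon> / (2 * real (Suc n))"
    by metis
  have B_events [measurable]: "B i \<in> events" for i using B G by auto
  note A [measurable]
  have BG: "(\<Union>i<m. B i) \<in> G" for m
    by (induction m) (auto simp: lessThan_Suc intro: G B)
  let ?D = "\<lambda>i. (A i - B i) \<union> (B i - A i)"
  let ?R = "(\<Union>i. A i) - (\<Union>i<n. A i)"
  have "prob (((\<Union>i. A i) - (\<Union>i<n. B i)) \<union> ((\<Union>i<n. B i) - (\<Union>i. A i))) \<le> prob (?R \<union> (\<Union>i<n. ?D i))"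
    by (intro finite_measure_mono) auto
  also have "\<dots> \<le> prob ?R + prob (\<Union>i<n. ?D i)"
    by (intro measure_Un_le) auto
  also have "prob ?R = prob (\<Union>i. A i) - prob (\<Union>i<n. A i)"
    by (intro finite_measure_Diff) auto
  also have "prob (\<Union>i<n. ?D i) \<le> (\<Sum>i<n. prob (?D i))"
    by (intro finite_measure_subadditive_finite) auto
  also have "(\<Sum>i<n. prob (?D i)) \<le> (\<Sum>i<n. \<epsilon> / (2 * real (Suc n)))"
    by (intro sum_mono less_imp_le B)
  also have "\<dots> \<le> \<epsilon> / 2" using Union.prems by (simp add: field_simps)
  finally have "prob (((\<Union>i. A i) - (\<Union>i<n. B i)) \<union> ((\<Union>i<n. B i) - (\<Union>i. A i))) < \<epsilon>"
    using n by simp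
  then show ?case using BG by blast
qed

subsection \<open>The law of a nearest-neighbour path\<close>

text \<open>Common form of both walks: decisions may depend on the whole history, so coins indexed
  by time and coins stacked at sites differ only in how a history is labelled.\<close>

primrec coin_path :: "(int list \<Rightarrow> bool) \<Rightarrow> nat \<Rightarrow> int list" where
  "coin_path d 0 = [0]"
| "coin_path d (Suc n) = (let p = coin_path d n in p @ [if d p then last p + 1 else last p - 1])"

lemma length_coin_path [simp]: "length (coin_path d n) = Suc n"
  by (induction n) (auto simp: Let_def)

lemma coin_path_not_Nil [simp]: "coin_path d n \<noteq> []"
  using length_coin_path[of d n] by (metis list.size(3) nat.distinct(1))

lemma nth_coin_path: "i \<le> n \<Longrightarrow> coin_path d n ! i = last (coin_path d i)"
proof (induction n)
  case (Suc n)
  show ?case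
  proof (cases "i = Suc n")
    case True
    then show ?thesis by (simp add: last_conv_nth del: coin_path.simps)
  next
    case False
    then show ?thesis using Suc by (simp add: Let_def nth_append)
  qed
qed simp

lemma erw_path_eq_coin_path:
  "erw_path 0 \<omega> U n = coin_path (\<lambda>p. U (length p - 1) < \<omega> (last p) (count_list p (last p) - 1)) n"
  by (induction n) (simp_all add: Let_def)

text \<open>The label of the arrow to be read after history \<open>p\<close>. The count includes the
  present visit, so subtracting one gives a 0-based depth.\<close>

definition stack_index :: "int list \<Rightarrow> int \<times> nat" where
  "stack_index p = (last p, count_list p (last p) - 1)"

text \<open>The history list contains the position at time \<open>n\<close>, which
  \<open>visits a n\<close> does not count; hence \<open>Suc n\<close>.\<close>

lemma coin_path_stack:
  "last (coin_path (\<lambda>p. a (fst (stack_index p)) (snd (stack_index p))) n) = walk a n \<and>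
   (\<forall>x. count_list (coin_path (\<lambda>p. a (fst (stack_index p)) (snd (stack_index p))) n) x = visits a (Suc n) x)"
  by (induction n) (auto simp: Let_def stack_index_def)

definition step_set :: "(int list \<Rightarrow> real) \<Rightarrow> int list \<Rightarrow> int \<Rightarrow> real set" where
  "step_set \<theta> q z = (if z = last q + 1 then {..<\<theta> q} else if z = last q - 1 then {\<theta> q..} else {})"

lemma step_set_borel [measurable]: "step_set \<theta> q z \<in> sets borel"
  by (simp add: step_set_def)

text \<open>Once the path is prescribed, the adaptively chosen coins are known in advance: the event
  becomes a cylinder with one constraint for each proper nonempty prefix.\<close>

lemma coin_path_eq_iff:
  "coin_path (\<lambda>q. W (\<iota> q) < \<theta> q) n = p \<longleftrightarrow>
     length p = Suc n \<and> p ! 0 = 0 \<and>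
     (\<forall>i<n. W (\<iota> (take (Suc i) p)) \<in> step_set \<theta> (take (Suc i) p) (p ! Suc i))"
proof (induction n arbitrary: p)
  case 0
  show ?case by (auto simp: length_Suc_conv)
next
  case (Suc n)
  let ?d = "\<lambda>q. W (\<iota> q) < \<theta> q"
  show ?case
  proof (cases "length p = Suc (Suc n)")
    case True
    define q where "q = take (Suc n) p"
    have p: "p = q @ [p ! Suc n]"
      using True unfolding q_def by (metis lessI take_Suc_conv_app_nth take_all_iff order_refl)
    have lq: "length q = Suc n" using True by (simp add: q_def)
    have "coin_path ?d (Suc n) = p \<longleftrightarrow> coin_path ?d n = q \<and> (if ?d q then last q + 1 else last q - 1) = p ! Suc n"
      by (subst p) (auto simp: Let_def)
    also have "(if ?d q then last q + 1 else last q - 1) = p ! Suc n \<longleftrightarrow> W (\<iota> q) \<in> step_set \<theta> q (p ! Suc n)"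
      by (auto simp: step_set_def)
    also have "coin_path ?d n = q \<longleftrightarrow> p ! 0 = 0 \<and>
     (\<forall>i<n. W (\<iota> (take (Suc i) p)) \<in> step_set \<theta> (take (Suc i) p) (p ! Suc i))"
      unfolding Suc.IH using True lq by (auto simp: q_def min_def)
    finally show ?thesis using True by (auto simp: less_Suc_eq q_def)
  next
    case False
    then show ?thesis using length_coin_path[of ?d "Suc n"] by metis
  qed
qed

lemma measurable_coin_path:
  assumes d: "\<And>p. Measurable.pred M (\<lambda>s. d s p)"
  shows "(\<lambda>s. coin_path (d s) n) \<in> measurable M (count_space UNIV)"
proof (induction n)
  case (Suc n)
  have "(\<lambda>s. (\<lambda>p s. p @ [if d s p then last p + 1 else last p - 1]) (coin_path (d s) n) s) \<in> measurable M (count_space UNIV)"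
    by (rule measurable_compose_countable[OF _ Suc]) (use d in measurable)
  then show ?case by (simp add: Let_def)
qed simp

text \<open>No coin is read twice along a path. This is the property that makes the steps
  independent draws.\<close>

definition injective_on_prefixes :: "(int list \<Rightarrow> 'i) \<Rightarrow> bool" where
  "injective_on_prefixes \<iota> \<longleftrightarrow> (\<forall>p n. n < length p \<longrightarrow> inj_on (\<lambda>i. \<iota> (take (Suc i) p)) {..<n})"

lemma injective_on_prefixes_time: "injective_on_prefixes (\<lambda>p. length p - 1)"
  unfolding injective_on_prefixes_def by (auto simp: inj_on_def)

lemma count_list_take_mono: "i \<le> j \<Longrightarrow> count_list (take i p) x \<le> count_list (take j p) x"
  by (metis count_list_append le_add1 le_add_diff_inverse take_add)

lemma injective_on_prefixes_stack: "injective_on_prefixes stack_index"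
  unfolding injective_on_prefixes_def
proof (intro allI impI)
  fix p :: "int list" and n assume n: "n < length p"
  have "stack_index (take (Suc i) p) \<noteq> stack_index (take (Suc j) p)" if "i < j" "j < n" for i j
  proof
    assume eq: "stack_index (take (Suc i) p) = stack_index (take (Suc j) p)"
    have take: "take (Suc k) p = take k p @ [p ! k]" if "k < n" for k
      using that n by (simp add: take_Suc_conv_app_nth)
    have "count_list (take (Suc i) p) (p ! j) \<le> count_list (take j p) (p ! j)"
      using that by (intro count_list_take_mono) auto
    moreover have *: "p ! i = p ! j" "count_list (take i p) (p ! i) = count_list (take j p) (p ! j)"
      using eq that by (auto simp: stack_index_def take)
    ultimately show False using that by (simp add: take)
  qed
  then show "inj_on (\<lambda>i. stack_index (take (Suc i) p)) {..<n}"
    by (intro linorder_inj_onI) auto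
qed

text \<open>Distinct coins turn the cylinder probability into a product that involves the thresholds
  but no longer the labelling.\<close>

lemma emeasure_coin_path:
  fixes \<iota> :: "int list \<Rightarrow> 'i"
  assumes inj: "injective_on_prefixes \<iota>"
  shows "emeasure iid_uniform {W. coin_path (\<lambda>q. W (\<iota> q) < \<theta> q) n = p} =
    (if length p = Suc n \<and> p ! 0 = 0
     then \<Prod>i<n. emeasure (uniform_measure lborel {0..1}) (step_set \<theta> (take (Suc i) p) (p ! Suc i)) else 0)"
proof (cases "length p = Suc n \<and> p ! 0 = 0")
  case True
  let ?g = "\<lambda>i. \<iota> (take (Suc i) p)"
  let ?S = "\<lambda>i. step_set \<theta> (take (Suc i) p) (p ! Suc i)"
  have g: "inj_on ?g {..<n}" using inj True by (auto simp: injective_on_prefixes_def)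
  \<comment> \<open>\<open>h\<close> recovers from a coin label the time at which this path reads
    it, so that the cylinder can be indexed by labels.\<close>
  define h where "h = the_inv_into {..<n} ?g"
  have h: "h (?g i) = i" if "i < n" for i
    unfolding h_def using g that by (intro the_inv_into_f_f) auto
  have "{W. coin_path (\<lambda>q. W (\<iota> q) < \<theta> q) n = p} = {W. \<forall>j\<in>?g ` {..<n}. W j \<in> ?S (h j)}"
    using True h by (auto simp: coin_path_eq_iff)
  also have "emeasure iid_uniform \<dots> = (\<Prod>j\<in>?g ` {..<n}. emeasure (uniform_measure lborel {0..1}) (?S (h j)))"
    by (rule emeasure_iid_uniform_cylinder) auto
  also have "\<dots> = (\<Prod>i<n. emeasure (uniform_measure lborel {0..1}) (?S i))"
    using g h by (subst prod.reindex) (auto intro!: prod.cong)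
  finally show ?thesis using True by simp
next
  case False
  then have "{W. coin_path (\<lambda>q. W (\<iota> q) < \<theta> q) n = p} = {}"
    unfolding coin_path_eq_iff by blast
  then show ?thesis using False by (simp only: emeasure_empty if_False)
qed

lemma distr_coin_walk_eq:
  fixes \<iota> :: "int list \<Rightarrow> 'i" and \<kappa> :: "int list \<Rightarrow> 'j"
  assumes \<iota>: "injective_on_prefixes \<iota>" and \<kappa>: "injective_on_prefixes \<kappa>"
  shows "distr iid_uniform (PiM UNIV (\<lambda>_. count_space UNIV)) (\<lambda>W n. last (coin_path (\<lambda>q. W (\<iota> q) < \<theta> q) n))
       = distr iid_uniform (PiM UNIV (\<lambda>_. count_space UNIV)) (\<lambda>W n. last (coin_path (\<lambda>q. W (\<kappa> q) < \<theta> q) n))"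
    (is "?L = ?R")
proof -
  let ?P = "PiM UNIV (\<lambda>_::nat. count_space (UNIV :: int set))"
  have path: "(\<lambda>W. coin_path (\<lambda>q. W (\<iota> q) < \<theta> q) n) \<in> measurable iid_uniform (count_space UNIV)"
    for \<iota> :: "int list \<Rightarrow> 'k" and n
    by (rule measurable_coin_path) measurable
  have walk: "(\<lambda>W n. last (coin_path (\<lambda>q. W (\<iota> q) < \<theta> q) n)) \<in> measurable iid_uniform ?P"
    for \<iota> :: "int list \<Rightarrow> 'k"
    by (rule measurable_PiM_single') (auto intro!: measurable_compose[OF path])
  have path_law: "distr iid_uniform (count_space UNIV) (\<lambda>W. coin_path (\<lambda>q. W (\<iota> q) < \<theta> q) n)
      = distr iid_uniform (count_space UNIV) (\<lambda>W. coin_path (\<lambda>q. W (\<kappa> q) < \<theta> q) n)" for n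
  proof (rule measure_eqI_countable[of _ UNIV])
    fix p
    show "emeasure (distr iid_uniform (count_space UNIV) (\<lambda>W. coin_path (\<lambda>q. W (\<iota> q) < \<theta> q) n)) {p}
      = emeasure (distr iid_uniform (count_space UNIV) (\<lambda>W. coin_path (\<lambda>q. W (\<kappa> q) < \<theta> q) n)) {p}"
      using emeasure_coin_path[OF \<iota>, of \<theta> n p] emeasure_coin_path[OF \<kappa>, of \<theta> n p]
      by (simp add: emeasure_distr[OF path] vimage_def)
  qed auto
  \<comment> \<open>Finitely many positions are entries of one finite path; inserting
    \<open>0\<close> makes the maximum meaningful for empty \<open>J\<close>.\<close>
  have cylinder: "emeasure (distr iid_uniform ?P (\<lambda>W n. last (coin_path (\<lambda>q. W (\<iota> q) < \<theta> q) n))) (prod_emb UNIV (\<lambda>_. count_space UNIV) J (Pi\<^sub>E J F))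
      = emeasure (distr iid_uniform (count_space UNIV) (\<lambda>W. coin_path (\<lambda>q. W (\<iota> q) < \<theta> q) (Max (insert 0 J)))) {p. \<forall>j\<in>J. p ! j \<in> F j}"
    if J: "finite J" for \<iota> :: "int list \<Rightarrow> 'k" and J F
  proof -
    have "prod_emb UNIV (\<lambda>_. count_space UNIV) J (Pi\<^sub>E J F) = {x::nat \<Rightarrow> int. \<forall>j\<in>J. x j \<in> F j}"
      by (auto simp: prod_emb_def PiE_iff)
    moreover have "{x::nat \<Rightarrow> int. \<forall>j\<in>J. x j \<in> F j} \<in> sets ?P"
      using calculation sets_PiM_I[of J UNIV F "\<lambda>_. count_space (UNIV :: int set)"] J by simp
    moreover have "(\<forall>j\<in>J. last (coin_path (\<lambda>q. W (\<iota> q) < \<theta> q) j) \<in> F j)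
        \<longleftrightarrow> (\<forall>j\<in>J. coin_path (\<lambda>q. W (\<iota> q) < \<theta> q) (Max (insert 0 J)) ! j \<in> F j)" for W
      using J by (intro ball_cong refl) (simp add: nth_coin_path)
    ultimately show ?thesis
      by (simp add: emeasure_distr[OF walk] emeasure_distr[OF path] vimage_def)
  qed
  show ?thesis
  proof (rule measure_eqI_PiM_infinite)
    show "finite_measure ?L"
      by (rule prob_space.finite_measure) (intro iid_uniform.prob_space_distr walk)
    fix F and J :: "nat set" assume "finite J"
    then show "emeasure ?L (prod_emb UNIV (\<lambda>_. count_space UNIV) J (Pi\<^sub>E J F))
        = emeasure ?R (prod_emb UNIV (\<lambda>_. count_space UNIV) J (Pi\<^sub>E J F))"
      by (simp add: cylinder path_law)
  qed auto
qed


subsection \<open>Cookie environments with stacks of uniform variables\<close>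

lemma distr_funpow:
  assumes [measurable]: "T \<in> measurable M M" and T: "distr M M T = M"
  shows "(T ^^ n) \<in> measurable M M" "distr M M (T ^^ n) = M"
proof -
  show meas: "(T ^^ n) \<in> measurable M M" for n
    by (induction n) (auto intro: measurable_comp)
  show "distr M M (T ^^ n) = M"
  proof (induction n)
    case (Suc n)
    have "distr M M (T ^^ Suc n) = distr (distr M M (T ^^ n)) M T"
      by (subst distr_distr) (auto simp: meas)
    then show ?case by (simp only: Suc T)
  qed (simp add: distr_id id_def)
qed

lemma pred_tendsto:
  fixes f :: "nat \<Rightarrow> 'a \<Rightarrow> real"
  assumes [measurable]: "\<And>n. f n \<in> borel_measurable M"
  shows "Measurable.pred M (\<lambda>s. (\<lambda>n. f n s) \<longlonglongrightarrow> v)"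
proof -
  have "(x \<longlonglongrightarrow> v) \<longleftrightarrow> (\<forall>k. \<exists>N. \<forall>n\<ge>N. \<bar>x n - v\<bar> < inverse (real (Suc k)))" for x :: "nat \<Rightarrow> real"
    unfolding LIMSEQ_def dist_real_def
    by (meson less_trans reals_Archimedean inverse_positive_iff_positive of_nat_0_less_iff zero_less_Suc)
  then show ?thesis by simp
qed

lemma determined_by_mono: "determined_by J B \<Longrightarrow> J \<subseteq> K \<Longrightarrow> determined_by K B"
  unfolding determined_by_def by blast

lemma determined_by_Compl: "determined_by J B \<Longrightarrow> determined_by J (- B)"
  unfolding determined_by_def by (metis ComplD ComplI)

lemma determined_by_Un: "determined_by J B \<Longrightarrow> determined_by J C \<Longrightarrow> determined_by J (B \<union> C)"
  unfolding determined_by_def by blast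

type_synonym stack_env = "cookie_env \<times> (int \<times> nat \<Rightarrow> real)"

definition translate :: "int \<Rightarrow> stack_env \<Rightarrow> stack_env" where
  "translate y s = (\<lambda>x. fst s (x + y), \<lambda>i. snd s (fst i + y, snd i))"

definition arrows :: "stack_env \<Rightarrow> int \<Rightarrow> nat \<Rightarrow> bool" where
  "arrows s x k \<longleftrightarrow> snd s (x, k) < fst s x k"

lemma translate_funpow: "(translate 1 ^^ n) = translate (int n)"
  by (induction n) (auto simp: translate_def fun_eq_iff ac_simps)

lemma translate_inverse [simp]: "translate (- 1) (translate 1 s) = s" "translate 1 (translate (- 1) s) = s"
  by (simp_all add: translate_def)

lemma arrows_translate: "arrows (translate y s) x = arrows s (x + y)"
  by (simp add: arrows_def translate_def fun_eq_iff)

locale cookie_law = prob_space \<mu> for \<mu> :: "cookie_env measure" +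
  assumes sets_law: "sets \<mu> = sets cookie_M"
    and law_stationary: "stationary \<mu>"
    and law_ergodic: "ergodic \<mu>"
    and law_elliptic: "elliptic \<mu>"
begin

lemma space_law [simp]: "space \<mu> = UNIV"
  using sets_eq_imp_space_eq[OF sets_law] by (simp add: cookie_M_def space_PiM)

lemma cookie_measurable [measurable]: "(\<lambda>\<omega>. \<omega> x n) \<in> borel_measurable \<mu>"
proof -
  have "(\<lambda>\<omega>. \<omega> x) \<in> measurable cookie_M (PiM UNIV (\<lambda>_. borel))"
    unfolding cookie_M_def by (rule measurable_component_singleton) simp
  moreover have "(\<lambda>f. f n) \<in> measurable (PiM UNIV (\<lambda>_::nat. borel :: real measure)) borel"
    by (rule measurable_component_singleton) simp
  ultimately have "(\<lambda>\<omega>. \<omega> x n) \<in> borel_measurable cookie_M"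
    by (rule measurable_compose)
  then show ?thesis using sets_law by (simp cong: measurable_cong_sets)
qed

lemma measurable_into_law:
  assumes "\<And>x n. (\<lambda>s. f s x n) \<in> borel_measurable M"
  shows "f \<in> measurable M \<mu>"
proof -
  have "f \<in> measurable M cookie_M"
    unfolding cookie_M_def by (intro measurable_PiM_single') (auto simp: assms space_PiM)
  then show ?thesis using sets_law by (simp cong: measurable_cong_sets)
qed

abbreviation env :: "stack_env measure" where
  "env \<equiv> \<mu> \<Otimes>\<^sub>M iid_uniform"

sublocale P: pair_prob_space \<mu> "iid_uniform :: (int \<times> nat \<Rightarrow> real) measure"
  by unfold_locales

lemma space_env [simp]: "space env = UNIV"
  by (simp add: space_pair_measure)

lemma translate_measurable [measurable]: "translate y \<in> measurable env env"
  unfolding translate_def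
  by (intro measurable_Pair measurable_into_law measurable_into_iid_uniform) measurable

lemma translate_preserving: "distr env env (translate 1) = env"
proof -
  let ?f = "\<lambda>V (i :: int \<times> nat). V (fst i + 1, snd i) :: real"
  have inj: "inj (\<lambda>i :: int \<times> nat. (fst i + 1, snd i))"
    by (auto simp: inj_on_def prod_eq_iff)
  have f: "distr iid_uniform iid_uniform ?f = iid_uniform"
    using distr_iid_uniform_reindex[OF inj] .
  have "translate 1 = (\<lambda>(\<omega>, V). (shift \<omega>, ?f V))"
    by (auto simp: translate_def shift_def)
  moreover have "distr \<mu> \<mu> shift \<Otimes>\<^sub>M distr iid_uniform iid_uniform ?f = distr env env (\<lambda>(\<omega>, V). (shift \<omega>, ?f V))"
  proof (rule pair_measure_distr)
    show "shift \<in> measurable \<mu> \<mu>" using law_stationary by (simp add: stationary_def)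
    show "?f \<in> measurable iid_uniform iid_uniform"
      by (rule measurable_into_iid_uniform) measurable
    show "sigma_finite_measure (distr iid_uniform iid_uniform ?f)"
      unfolding f by unfold_locales
  qed
  moreover have "distr \<mu> \<mu> shift = \<mu>" using law_stationary by (simp add: stationary_def)
  ultimately show ?thesis using f by simp
qed

lemma measure_translate: "B \<in> sets env \<Longrightarrow> measure env (translate (int n) -` B) = measure env B"
  using distr_funpow[OF translate_measurable translate_preserving, of n]
  by (metis measure_distr translate_funpow space_env Int_UNIV_right)

section \<open>Conditional probabilities given the cookies\<close>

definition section_prob :: "stack_env set \<Rightarrow> cookie_env \<Rightarrow> real" where
  "section_prob B \<omega> = measure iid_uniform (Pair \<omega> -` B)"

lemma section_sets: "B \<in> sets env \<Longrightarrow> Pair \<omega> -` B \<in> sets iid_uniform"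
  by (rule sets_Pair1)

lemma section_prob_measurable [measurable]: "B \<in> sets env \<Longrightarrow> section_prob B \<in> borel_measurable \<mu>"
  unfolding section_prob_def measure_def using iid_uniform.measurable_emeasure_Pair by measurable

lemma section_prob_nonneg: "0 \<le> section_prob B \<omega>"
  by (simp add: section_prob_def)

lemma section_prob_le_1: "section_prob B \<omega> \<le> 1"
  by (simp add: section_prob_def)

lemma integrable_section_prob: "B \<in> sets env \<Longrightarrow> integrable \<mu> (section_prob B)"
  by (rule integrable_const_bound[of _ 1]) (auto simp: section_prob_nonneg section_prob_le_1)

lemma measure_env: "B \<in> sets env \<Longrightarrow> measure env B = (\<integral>\<omega>. section_prob B \<omega> \<partial>\<mu>)"
proof -
  assume B: "B \<in> sets env"
  have "emeasure env B = (\<integral>\<^sup>+\<omega>. ennreal (section_prob B \<omega>) \<partial>\<mu>)"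
    using iid_uniform.emeasure_pair_measure_alt[OF B] by (simp add: section_prob_def iid_uniform.emeasure_eq_measure)
  also have "\<dots> = ennreal (\<integral>\<omega>. section_prob B \<omega> \<partial>\<mu>)"
    using integrable_section_prob[OF B] by (rule nn_integral_eq_integral) (simp add: section_prob_nonneg)
  finally show ?thesis
    by (simp add: measure_def integral_nonneg section_prob_nonneg)
qed

lemma section_prob_diff:
  assumes "B \<in> sets env" "C \<in> sets env"
  shows "\<bar>section_prob B \<omega> - section_prob C \<omega>\<bar> \<le> section_prob ((B - C) \<union> (C - B)) \<omega>"
proof -
  have le: "section_prob B \<omega> \<le> section_prob C \<omega> + section_prob ((B - C) \<union> (C - B)) \<omega>"
    if "B \<in> sets env" "C \<in> sets env" for B C
  proof -
    have "measure iid_uniform (Pair \<omega> -` B) \<le> measure iid_uniform (Pair \<omega> -` C \<union> Pair \<omega> -` ((B - C) \<union> (C - B)))"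
      using that by (intro iid_uniform.finite_measure_mono sets.Un section_sets) auto
    also have "\<dots> \<le> measure iid_uniform (Pair \<omega> -` C) + measure iid_uniform (Pair \<omega> -` ((B - C) \<union> (C - B)))"
      using that by (intro measure_Un_le section_sets) auto
    finally show ?thesis by (simp add: section_prob_def)
  qed
  show ?thesis using le[OF assms] le[OF assms(2) assms(1)] by (simp add: Un_commute abs_le_iff)
qed

lemma section_prob_indep:
  assumes "B \<in> sets env" "C \<in> sets env" "J \<inter> K = {}"
    "determined_by J (Pair \<omega> -` B)" "determined_by K (Pair \<omega> -` C)"
  shows "section_prob (B \<inter> C) \<omega> = section_prob B \<omega> * section_prob C \<omega>"
  using iid_uniform_indep[OF section_sets[OF assms(1)] section_sets[OF assms(2)] assms(4,5,3)]
  by (simp add: section_prob_def)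

text \<open>The stacks have a translation-invariant law, so the conditional probability of an
  invariant event is a shift-invariant function of the cookies. The set where it lies below its mean
  \<open>q\<close> is invariant and cannot have full measure, hence is null; a function that is at
  least its mean equals it almost everywhere.\<close>

lemma section_prob_invariant:
  assumes A: "A \<in> sets env" and inv: "translate 1 -` A = A"
  shows "AE \<omega> in \<mu>. section_prob A \<omega> = measure env A"
proof -
  define q where "q = measure env A"
  have [measurable]: "section_prob A \<in> borel_measurable \<mu>" using A by simp
  have inj: "inj (\<lambda>i :: int \<times> nat. (fst i + 1, snd i))"
    by (auto simp: inj_on_def prod_eq_iff)
  have sec: "section_prob A (shift \<omega>) = section_prob A \<omega>" for \<omega>
  proof -
    let ?f = "\<lambda>V (i :: int \<times> nat). V (fst i + 1, snd i) :: real"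
    have "?f -` (Pair (shift \<omega>) -` A) = Pair \<omega> -` (translate 1 -` A)"
      by (auto simp: translate_def shift_def)
    then have "?f -` (Pair (shift \<omega>) -` A) = Pair \<omega> -` A" by (simp only: inv)
    moreover have "?f \<in> measurable iid_uniform iid_uniform"
      by (rule measurable_into_iid_uniform) measurable
    ultimately have "measure (distr iid_uniform iid_uniform ?f) (Pair (shift \<omega>) -` A) = section_prob A \<omega>"
      using section_sets[OF A] by (simp add: measure_distr section_prob_def)
    then show ?thesis
      using distr_iid_uniform_reindex[OF inj] by (simp add: section_prob_def)
  qed
  define E where "E = {\<omega>. section_prob A \<omega> < q}"
  have E: "E \<in> sets \<mu>"
  proof -
    have "{\<omega>\<in>space \<mu>. section_prob A \<omega> < q} \<in> sets \<mu>" by measurable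
    then show ?thesis by (simp add: E_def)
  qed
  have "shift -` E \<inter> space \<mu> = E" by (auto simp: E_def sec)
  then have "emeasure \<mu> E = 0 \<or> emeasure \<mu> E = 1"
    using law_ergodic E unfolding ergodic_def by blast
  moreover have "emeasure \<mu> E \<noteq> 1"
  proof
    assume "emeasure \<mu> E = 1"
    then have "AE \<omega> in \<mu>. \<omega> \<in> E" using E by (simp add: AE_in_set_eq_1 measure_def)
    then have "AE \<omega> in \<mu>. section_prob A \<omega> < q" by eventually_elim (simp add: E_def)
    then have "(\<integral>\<omega>. section_prob A \<omega> \<partial>\<mu>) < (\<integral>\<omega>. q \<partial>\<mu>)"
      using integrable_section_prob[OF A] by (intro integral_less_AE_space) (auto simp: emeasure_space_1[simplified])
    then show False using measure_env[OF A] by (simp add: q_def prob_space[simplified])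
  qed
  ultimately have "E \<in> null_sets \<mu>" using E by auto
  from AE_not_in[OF this] have ge: "AE \<omega> in \<mu>. q \<le> section_prob A \<omega>"
    by eventually_elim (simp add: E_def)
  have int: "integrable \<mu> (\<lambda>\<omega>. section_prob A \<omega> - q)" using integrable_section_prob[OF A] by simp
  have "(\<integral>\<omega>. section_prob A \<omega> - q \<partial>\<mu>) = 0"
    using integrable_section_prob[OF A] measure_env[OF A] by (simp add: q_def prob_space[simplified])
  then have "AE \<omega> in \<mu>. section_prob A \<omega> - q = 0"
    using ge by (subst (asm) integral_nonneg_eq_0_iff_AE[OF int]) auto
  then show ?thesis by eventually_elim (simp add: q_def)
qed

text \<open>Only the stacks are confined to a finite window of sites, at arbitrary depth. The
  dependence on the cookies is unrestricted, because independence is sought only conditionally on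
  them.\<close>

definition local_sets :: "stack_env set set" where
  "local_sets = {B \<in> sets env. \<exists>n::nat. \<forall>\<omega>. determined_by {i. \<bar>fst i\<bar> \<le> int n} (Pair \<omega> -` B)}"

text \<open>Both projections are measurable for the sigma-algebra generated by the local events,
  hence so is the identity map into \<open>env\<close>.\<close>

lemma sets_env_local: "sets env \<subseteq> sigma_sets UNIV local_sets"
proof
  let ?S = "sigma UNIV local_sets"
  have sets_S: "sets ?S = sigma_sets UNIV local_sets" by simp
  have fst: "(\<lambda>s. fst s) \<in> measurable ?S \<mu>"
  proof (rule measurableI)
    fix B assume B: "B \<in> sets \<mu>"
    have "fst -` B \<inter> space env \<in> sets env" using B by measurable
    then have "fst -` B \<in> local_sets"
      by (auto simp: local_sets_def determined_by_def)
    then show "(\<lambda>s. fst s) -` B \<inter> space ?S \<in> sets ?S" by (auto simp: sets_S)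
  qed simp
  have snd: "(\<lambda>s. snd s) \<in> measurable ?S iid_uniform"
  proof (rule measurable_into_iid_uniform)
    fix i
    show "(\<lambda>s. snd s i) \<in> borel_measurable ?S"
    proof (rule measurableI)
      fix B :: "real set" assume B: "B \<in> sets borel"
      have "(\<lambda>s. snd s i) -` B \<inter> space env \<in> sets env" using B by measurable
      then have "(\<lambda>s. snd s i) -` B \<in> local_sets"
        by (cases i) (auto simp: local_sets_def determined_by_def intro!: exI[of _ "nat \<bar>fst i\<bar>"])
      then show "(\<lambda>s. snd s i) -` B \<inter> space ?S \<in> sets ?S" by (auto simp: sets_S)
    qed simp
  qed
  have "(\<lambda>s. (fst s, snd s)) \<in> measurable ?S env" using fst snd by (rule measurable_Pair)
  then have id: "(\<lambda>s. s) \<in> measurable ?S env" by simp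
  fix A assume "A \<in> sets env"
  from measurable_sets[OF id this] show "A \<in> sigma_sets UNIV local_sets" by (simp add: sets_S)
qed

lemma local_approximation:
  assumes "A \<in> sets env" "0 < \<epsilon>"
  obtains B where "B \<in> local_sets" "measure env ((A - B) \<union> (B - A)) < \<epsilon>"
proof -
  have "\<exists>B\<in>local_sets. measure env ((A - B) \<union> (B - A)) < \<epsilon>"
  proof (rule P.approximation_by_algebra)
    show "local_sets \<subseteq> sets env" by (auto simp: local_sets_def)
    show "{} \<in> local_sets" by (auto simp: local_sets_def determined_by_def)
    show "space env - B \<in> local_sets" if "B \<in> local_sets" for B
    proof -
      obtain n where "\<And>\<omega>. determined_by {i. \<bar>fst i\<bar> \<le> int n} (Pair \<omega> -` B)"
        using \<open>B \<in> local_sets\<close> by (auto simp: local_sets_def)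
      then have "determined_by {i. \<bar>fst i\<bar> \<le> int n} (Pair \<omega> -` (space env - B))" for \<omega>
        using determined_by_Compl[of "{i. \<bar>fst i\<bar> \<le> int n}" "Pair \<omega> -` B"]
        by (simp add: vimage_Diff Compl_eq_Diff_UNIV)
      moreover have "space env - B \<in> sets env"
        using \<open>B \<in> local_sets\<close> by (intro sets.compl_sets) (simp add: local_sets_def)
      ultimately show ?thesis unfolding local_sets_def by blast
    qed
    show "B \<union> C \<in> local_sets" if B: "B \<in> local_sets" and C: "C \<in> local_sets" for B C
    proof -
      obtain m n where m: "\<And>\<omega>. determined_by {i. \<bar>fst i\<bar> \<le> int m} (Pair \<omega> -` B)"
          and n: "\<And>\<omega>. determined_by {i. \<bar>fst i\<bar> \<le> int n} (Pair \<omega> -` C)"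
        using B C by (auto simp: local_sets_def)
      have "determined_by {i. \<bar>fst i\<bar> \<le> int (max m n)} (Pair \<omega> -` (B \<union> C))" for \<omega>
        unfolding vimage_Un
        by (intro determined_by_Un determined_by_mono[OF m] determined_by_mono[OF n]) auto
      moreover have "B \<union> C \<in> sets env" using B C by (simp add: local_sets_def sets.Un)
      ultimately show ?thesis unfolding local_sets_def by blast
    qed
    show "A \<in> sigma_sets (space env) local_sets" using assms sets_env_local by auto
  qed (fact assms)
  then show ?thesis using that by blast
qed

text \<open>An invariant event is approximated by a local event \<open>B\<close>, hence also by the translates of
  \<open>B\<close>, which for large translations are independent of \<open>B\<close> given the cookies.
  Since its conditional probability given the cookies is constant, its probability \<open>q\<close>
  satisfies \<open>q = q\<^sup>2\<close>.\<close>

lemma ergodic_map_translate: "ergodic_map env (translate 1)"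
proof
  show "translate 1 \<in> measurable env env" by simp
  show "distr env env (translate 1) = env" by (rule translate_preserving)
  fix A assume A: "A \<in> sets env" and "translate 1 -` A \<inter> space env = A"
  then have inv1: "translate 1 -` A = A" by simp
  have inv: "translate (int n) -` A = A" for n
  proof (induction n)
    case 0
    show ?case by (simp add: translate_def)
  next
    case (Suc n)
    have "translate (int (Suc n)) = translate 1 \<circ> translate (int n)"
      by (simp only: translate_funpow[symmetric] funpow.simps)
    then have "translate (int (Suc n)) -` A = translate (int n) -` (translate 1 -` A)"
      by (simp add: vimage_comp)
    then show ?case using Suc inv1 by simp
  qed
  define q where "q = measure env A"
  have q: "0 \<le> q" "q \<le> 1" by (simp_all add: q_def)
  have "\<bar>q - q * q\<bar> \<le> 4 * \<epsilon>" if "0 < \<epsilon>" for \<epsilon>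
  proof -
    obtain B where B: "B \<in> local_sets" "measure env ((A - B) \<union> (B - A)) < \<epsilon>"
      using local_approximation[OF A \<open>0 < \<epsilon>\<close>] .
    then obtain n where n: "\<And>\<omega>. determined_by {i. \<bar>fst i\<bar> \<le> int n} (Pair \<omega> -` B)"
      and [measurable]: "B \<in> sets env"
      by (auto simp: local_sets_def)
    \<comment> \<open>The smallest translation that makes the windows of radius \<open>n\<close>
      around \<open>0\<close> and \<open>k\<close> disjoint.\<close>
    define k where "k = 2 * n + 1"
    define C where "C = translate (int k) -` B"
    have C_sets [measurable]: "C \<in> sets env"
      using measurable_sets[OF translate_measurable, of B "int k"] by (simp add: C_def)
    note A [measurable]
    have C_det: "determined_by {i. \<bar>fst i - int k\<bar> \<le> int n} (Pair \<omega> -` C)" for \<omega>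
      unfolding determined_by_def
    proof (intro allI impI)
      fix V V' :: "int \<times> nat \<Rightarrow> real"
      assume eq: "\<forall>i\<in>{i. \<bar>fst i - int k\<bar> \<le> int n}. V i = V' i" and V: "V \<in> Pair \<omega> -` C"
      let ?f = "\<lambda>V i. V (fst i + int k, snd i) :: real"
      have "?f V \<in> Pair (\<lambda>x. \<omega> (x + int k)) -` B"
        using V by (simp add: C_def translate_def)
      moreover have "\<forall>i\<in>{i. \<bar>fst i\<bar> \<le> int n}. ?f V i = ?f V' i" using eq by simp
      ultimately have "?f V' \<in> Pair (\<lambda>x. \<omega> (x + int k)) -` B"
        using n[of "\<lambda>x. \<omega> (x + int k)", unfolded determined_by_def, rule_format, of "?f V" "?f V'"]
        by blast
      then show "V' \<in> Pair \<omega> -` C" by (simp add: C_def translate_def)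
    qed
    have AC: "measure env ((A - C) \<union> (C - A)) < \<epsilon>"
    proof -
      have "(A - C) \<union> (C - A) = translate (int k) -` ((A - B) \<union> (B - A))"
        unfolding C_def vimage_Un vimage_Diff inv ..
      moreover have "measure env (translate (int k) -` ((A - B) \<union> (B - A))) = measure env ((A - B) \<union> (B - A))"
        by (rule measure_translate) measurable
      ultimately show ?thesis using B(2) by simp
    qed
    have disj: "{i. \<bar>fst i\<bar> \<le> int n} \<inter> {i :: int \<times> nat. \<bar>fst i - int k\<bar> \<le> int n} = {}"
      by (auto simp: k_def)
    have "measure env (B \<inter> C) = (\<integral>\<omega>. section_prob (B \<inter> C) \<omega> \<partial>\<mu>)"
      by (rule measure_env) measurable
    then have BC: "measure env (B \<inter> C) = (\<integral>\<omega>. section_prob B \<omega> * section_prob C \<omega> \<partial>\<mu>)"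
      by (simp only: section_prob_indep[OF \<open>B \<in> sets env\<close> C_sets disj n C_det])
    let ?D = "\<lambda>B. (A - B) \<union> (B - A)"
    have int_BC: "integrable \<mu> (\<lambda>\<omega>. section_prob B \<omega> * section_prob C \<omega>)"
      by (rule integrable_const_bound[of _ 1])
         (auto simp: abs_mult section_prob_nonneg section_prob_le_1 intro!: mult_le_one)
    have "\<bar>(\<integral>\<omega>. section_prob B \<omega> * section_prob C \<omega> \<partial>\<mu>) - q * q\<bar>
        = \<bar>\<integral>\<omega>. section_prob B \<omega> * section_prob C \<omega> - q * q \<partial>\<mu>\<bar>"
      using int_BC by (simp add: prob_space[simplified])
    also have "\<dots> \<le> (\<integral>\<omega>. \<bar>section_prob B \<omega> * section_prob C \<omega> - q * q\<bar> \<partial>\<mu>)"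
      by (rule integral_abs_bound)
    also have "\<dots> \<le> (\<integral>\<omega>. section_prob (?D B) \<omega> + section_prob (?D C) \<omega> \<partial>\<mu>)"
    proof (rule integral_mono_AE)
      show "AE \<omega> in \<mu>. \<bar>section_prob B \<omega> * section_prob C \<omega> - q * q\<bar>
          \<le> section_prob (?D B) \<omega> + section_prob (?D C) \<omega>"
        using section_prob_invariant[OF A inv1]
      proof eventually_elim
        case (elim \<omega>)
        let ?b = "section_prob B \<omega>" and ?c = "section_prob C \<omega>"
        have "\<bar>?b * ?c - q * q\<bar> = \<bar>(?b - q) * ?c + q * (?c - q)\<bar>" by (simp add: algebra_simps)
        also have "\<dots> \<le> \<bar>?b - q\<bar> * ?c + q * \<bar>?c - q\<bar>"
          using q section_prob_nonneg[of C \<omega>] by (intro order_trans[OF abs_triangle_ineq]) (simp add: abs_mult)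
        also have "\<dots> \<le> \<bar>?b - q\<bar> * 1 + 1 * \<bar>?c - q\<bar>"
          using q section_prob_le_1[of C \<omega>] by (intro add_mono mult_left_mono mult_right_mono) auto
        also have "\<dots> \<le> section_prob (?D B) \<omega> + section_prob (?D C) \<omega>"
          using section_prob_diff[of A B \<omega>] section_prob_diff[of A C \<omega>] elim
          by (simp add: q_def abs_minus_commute)
        finally show ?case .
      qed
    qed (use int_BC in \<open>auto intro!: integrable_section_prob\<close>)
    also have "\<dots> = measure env (?D B) + measure env (?D C)"
      by (simp add: measure_env integrable_section_prob)
    finally have "\<bar>measure env (B \<inter> C) - q * q\<bar> \<le> 2 * \<epsilon>"
      using B(2) AC by (simp add: BC)
    moreover have "\<bar>measure env (B \<inter> C) - q\<bar> \<le> 2 * \<epsilon>"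
    proof -
      have "measure env (B \<inter> C) \<le> measure env (A \<union> ?D B)"
        by (intro P.finite_measure_mono) auto
      also have "\<dots> \<le> q + measure env (?D B)" unfolding q_def by (intro measure_Un_le) auto
      finally have 1: "measure env (B \<inter> C) \<le> q + \<epsilon>" using B(2) by simp
      have "q \<le> measure env ((B \<inter> C) \<union> (?D B \<union> ?D C))"
        unfolding q_def by (intro P.finite_measure_mono) auto
      also have "\<dots> \<le> measure env (B \<inter> C) + measure env (?D B \<union> ?D C)"
        by (intro measure_Un_le) auto
      also have "measure env (?D B \<union> ?D C) \<le> measure env (?D B) + measure env (?D C)"
        by (intro measure_Un_le) auto
      finally show ?thesis using 1 B(2) AC by simp
    qed
    ultimately show ?thesis by simp
  qed
  \<comment> \<open>If \<open>q\<close> differed from \<open>q * q\<close>, this tolerance would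
    bound the difference by half of itself.\<close>
  from this[of "\<bar>q - q * q\<bar> / 8"] have "q = q * q" by (cases "q = q * q") auto
  then have "q = 0 \<or> q = 1" by simp
  then show "emeasure env A = 0 \<or> emeasure env A = 1"
    by (simp add: q_def P.emeasure_eq_measure)
qed

text \<open>Given the cookies, \<open>D\<close> is independent of the arrows at \<open>0\<close>. By
  ellipticity the first \<open>m + 1\<close> of these all equal \<open>b\<close> with positive
  conditional probability, so a null intersection forces \<open>D\<close> to be null.\<close>

lemma finite_energy:
  assumes D: "D \<in> sets env" "\<And>\<omega>. determined_by {i. fst i \<noteq> 0} (Pair \<omega> -` D)"
    and null: "measure env (D \<inter> {s. \<forall>k\<le>m. arrows s 0 k = b}) = 0"
  shows "measure env D = 0"
proof -
  define G where "G = {s. \<forall>k\<le>m::nat. arrows s 0 k = b}"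
  have "{s\<in>space env. \<forall>k\<le>m. arrows s 0 k = b} \<in> sets env"
    unfolding arrows_def by measurable
  then have G: "G \<in> sets env" by (simp add: G_def)
  have G_det: "determined_by {i. fst i = 0} (Pair \<omega> -` G)" for \<omega>
    by (auto simp: determined_by_def G_def arrows_def)
  have mult: "section_prob (D \<inter> G) \<omega> = section_prob D \<omega> * section_prob G \<omega>" for \<omega>
    by (rule section_prob_indep[OF D(1) G _ D(2) G_det]) auto
  have "(\<integral>\<omega>. section_prob (D \<inter> G) \<omega> \<partial>\<mu>) = 0"
    using null measure_env[of "D \<inter> G"] D(1) G unfolding G_def[symmetric] by simp
  then have "AE \<omega> in \<mu>. section_prob (D \<inter> G) \<omega> = 0"
    using D G by (subst (asm) integral_nonneg_eq_0_iff_AE) (auto simp: section_prob_nonneg integrable_section_prob)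
  moreover have "AE \<omega> in \<mu>. \<forall>x n. 0 < \<omega> x n \<and> \<omega> x n < 1"
    using law_elliptic by (simp add: elliptic_def)
  ultimately have "AE \<omega> in \<mu>. section_prob D \<omega> = 0"
  proof eventually_elim
    case (elim \<omega>)
    define S where "S i = (if b then {..<\<omega> 0 (snd i)} else {\<omega> 0 (snd i)..})" for i :: "int \<times> nat"
    have "Pair \<omega> -` G = {V. \<forall>i\<in>Pair 0 ` {..m}. V i \<in> S i}"
      by (cases b) (auto simp: G_def arrows_def S_def not_less)
    also have "emeasure iid_uniform \<dots> = (\<Prod>i\<in>Pair 0 ` {..m}. emeasure (uniform_measure lborel {0..1}) (S i))"
      by (rule emeasure_iid_uniform_cylinder) (auto simp: S_def)
    also have "\<dots> \<noteq> 0"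
    proof -
      have "emeasure (uniform_measure lborel {0..1}) (S (0, k)) \<noteq> 0" for k
      proof -
        have "{0..1} \<inter> S (0, k) = (if b then {0..<\<omega> 0 k} else {\<omega> 0 k..1})"
          using elim(2)[rule_format, of 0 k] by (auto simp: S_def)
        then show ?thesis using elim(2)[rule_format, of 0 k] by (simp add: S_def)
      qed
      then show ?thesis by auto
    qed
    finally have "section_prob G \<omega> \<noteq> 0"
      by (simp add: section_prob_def iid_uniform.emeasure_eq_measure)
    then show ?case using elim(1) mult by simp
  qed
  from integral_eq_zero_AE[OF this] show ?thesis using measure_env[OF D(1)] by simp
qed

text \<open>\<open>B\<close> stands for the arrow field or its mirror image, and \<open>b\<close> is
  the original direction that counts as right in \<open>B\<close> at \<open>0\<close>. If zeros at
  \<open>0\<close> were null, finite energy would make every event \<open>D m\<close> null, although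
  finiteness at \<open>1\<close> puts almost every environment in some \<open>D m\<close>.\<close>

lemma total_branch_zero:
  fixes B :: "stack_env \<Rightarrow> int \<Rightarrow> nat \<Rightarrow> bool"
  assumes [measurable]: "\<And>x k. Measurable.pred env (\<lambda>s. B s x k)"
    and loc: "\<And>\<omega> V V' x. 1 \<le> x \<Longrightarrow> (\<And>i. fst i \<noteq> 0 \<Longrightarrow> V i = V' i) \<Longrightarrow> B (\<omega>, V) x = B (\<omega>, V') x"
    and B0: "\<And>s k. B s 0 k \<longleftrightarrow> arrows s 0 k = b"
    and fin: "AE s in env. total_branch (B s) 1 < \<infinity>"
  shows "\<not> (AE s in env. total_branch (B s) 0 \<noteq> 0)"
proof
  assume pos: "AE s in env. total_branch (B s) 0 \<noteq> 0"
  have [measurable]: "(\<lambda>s. total_branch (B s) x) \<in> borel_measurable env" for x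
    by (rule total_branch_measurable) measurable
  define D where "D m = {s. total_branch (B s) 1 \<le> of_nat m}" for m
  have D [measurable]: "D m \<in> sets env" for m
  proof -
    have "{s\<in>space env. total_branch (B s) 1 \<le> of_nat m} \<in> sets env" by measurable
    then show ?thesis by (simp add: D_def)
  qed
  have "measure env (D m) = 0" for m
  proof (rule finite_energy[OF D])
    show "determined_by {i. fst i \<noteq> 0} (Pair \<omega> -` D m)" for \<omega>
      unfolding determined_by_def
    proof (intro allI impI)
      fix V V' :: "int \<times> nat \<Rightarrow> real"
      assume "\<forall>i\<in>{i. fst i \<noteq> 0}. V i = V' i" and V: "V \<in> Pair \<omega> -` D m"
      then have "total_branch (B (\<omega>, V)) 1 = total_branch (B (\<omega>, V')) 1"
        by (intro total_branch_cong_right loc) auto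
      then show "V' \<in> Pair \<omega> -` D m" using V by (simp add: D_def)
    qed
    define N where "N = {s. total_branch (B s) 0 = 0}"
    have "{s\<in>space env. total_branch (B s) 0 = 0} \<in> sets env" by measurable
    then have N: "N \<in> sets env" by (simp add: N_def)
    have "measure env N = 0"
      using pos N by (subst P.prob_eq_0) (auto simp: N_def)
    moreover have "D m \<inter> {s. \<forall>k\<le>m. arrows s 0 k = b} \<subseteq> N"
      by (auto simp: D_def N_def B0 intro!: total_branch_eq_0I[where m = m])
    ultimately have "measure env (D m \<inter> {s. \<forall>k\<le>m. arrows s 0 k = b}) \<le> 0"
      using P.finite_measure_mono[OF _ N] by force
    then show "measure env (D m \<inter> {s. \<forall>k\<le>m. arrows s 0 k = b}) = 0"
      using measure_nonneg order_antisym by blast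
  qed
  then have "AE s in env. \<forall>m. s \<notin> D m"
    unfolding AE_all_countable by (intro allI AE_not_in null_setsI) (simp_all add: P.emeasure_eq_measure)
  with fin have "AE s in env. False"
  proof eventually_elim
    case (elim s)
    then obtain m where "total_branch (B s) 1 < of_nat m" using ennreal_Ex_less_of_nat by auto
    then show ?case using elim(2) by (auto simp: D_def dest: less_imp_le)
  qed
  then show False by simp
qed

section \<open>The arrow field and its reflection as arrow systems\<close>

lemma arrow_system_right: "arrow_system env (translate 1) (translate (- 1)) arrows"
proof -
  interpret ergodic_map env "translate 1" by (rule ergodic_map_translate)
  have [measurable]: "Measurable.pred env (\<lambda>s. arrows s x k)" for x k
    unfolding arrows_def by measurable
  show ?thesis
  proof
    assume "AE s in env. total_branch (arrows s) 1 < \<infinity>"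
    then show "\<not> (AE s in env. total_branch (arrows s) 0 \<noteq> 0)"
      by (intro total_branch_zero[where b = True]) (auto simp: arrows_def fun_eq_iff)
  qed (simp_all add: arrows_translate)
qed

text \<open>Reflection reverses translations, so the two maps swap roles; a right arrow of the
  mirrored field at \<open>0\<close> is a left arrow of the original, whence
  \<open>b = False\<close>.\<close>

lemma arrow_system_left: "arrow_system env (translate (- 1)) (translate 1) (\<lambda>s. mirror (arrows s))"
proof -
  interpret ergodic_map env "translate (- 1)"
    using arrow_system_right by (rule arrow_system.ergodic_map_inverse)
  have [measurable]: "Measurable.pred env (\<lambda>s. arrows s x k)" for x k
    unfolding arrows_def by measurable
  have [measurable]: "Measurable.pred env (\<lambda>s. mirror (arrows s) x k)" for x k
    unfolding mirror_def by measurable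
  show ?thesis
  proof
    assume "AE s in env. total_branch (mirror (arrows s)) 1 < \<infinity>"
    then show "\<not> (AE s in env. total_branch (mirror (arrows s)) 0 \<noteq> 0)"
      by (intro total_branch_zero[where b = False]) (auto simp: arrows_def mirror_def fun_eq_iff)
  qed (simp_all add: arrows_translate mirror_def fun_eq_iff)
qed

end

section \<open>Transfer to the excited random walk\<close>

lemma measurable_uniforms: "(\<lambda>U. U n) \<in> borel_measurable uniforms"
  using iid_uniform_coordinate[of n] by (simp add: uniforms_def iid_uniform_def)

lemma walk_arrows:
  "walk (arrows (\<omega>, V)) n
     = last (coin_path (\<lambda>q. V (stack_index q) < \<omega> (fst (stack_index q)) (snd (stack_index q))) n)"
  using coin_path_stack[of "arrows (\<omega>, V)" n] by (simp add: arrows_def)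

lemma erw_coin_path:
  "erw 0 \<omega> U n
     = last (coin_path (\<lambda>q. U (length q - 1) < \<omega> (fst (stack_index q)) (snd (stack_index q))) n)"
  by (simp add: erw_def erw_path_eq_coin_path stack_index_def)

text \<open>For fixed cookies both processes are coin walks with the same thresholds and different
  labellings, so \<open>distr_coin_walk_eq\<close> gives them the same quenched law.\<close>

lemma AE_erw_iff_AE_walk:
  assumes Q: "Measurable.pred (PiM UNIV (\<lambda>_. count_space UNIV)) Q"
  shows "(AE U in uniforms. Q (erw 0 \<omega> U)) \<longleftrightarrow> (AE V in iid_uniform. Q (walk (arrows (\<omega>, V))))"
proof -
  let ?P = "PiM UNIV (\<lambda>_::nat. count_space (UNIV :: int set))"
  let ?\<theta> = "\<lambda>q. \<omega> (fst (stack_index q)) (snd (stack_index q))"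
  let ?walk = "\<lambda>\<iota> W n. last (coin_path (\<lambda>q. W (\<iota> q) < ?\<theta> q) n)"
  have meas: "?walk \<iota> \<in> measurable iid_uniform ?P" for \<iota> :: "int list \<Rightarrow> 'k"
    by (rule measurable_PiM_single') (auto intro!: measurable_compose[OF measurable_coin_path])
  have AE: "(AE x in distr iid_uniform ?P (?walk \<iota>). Q x) \<longleftrightarrow> (AE W in iid_uniform. Q (?walk \<iota> W))"
    for \<iota> :: "int list \<Rightarrow> 'k"
    using Q by (intro AE_distr_iff meas) simp
  have uniforms: "uniforms = iid_uniform" by (simp add: uniforms_def iid_uniform_def)
  have walk: "walk (arrows (\<omega>, V)) = ?walk stack_index V" for V
    by (simp only: fun_eq_iff walk_arrows) simp
  have "erw 0 \<omega> U = ?walk (\<lambda>q. length q - 1) U" for U by (simp only: fun_eq_iff erw_coin_path) simp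
  then have "(AE U in uniforms. Q (erw 0 \<omega> U)) \<longleftrightarrow> (AE U in iid_uniform. Q (?walk (\<lambda>q. length q - 1) U))"
    by (simp only: uniforms)
  also have "\<dots> \<longleftrightarrow> (AE x in distr iid_uniform ?P (?walk (\<lambda>q. length q - 1)). Q x)"
    by (rule AE[symmetric])
  also have "\<dots> \<longleftrightarrow> (AE x in distr iid_uniform ?P (?walk stack_index). Q x)"
    by (simp only: distr_coin_walk_eq[OF injective_on_prefixes_time injective_on_prefixes_stack, of ?\<theta>])
  also have "\<dots> \<longleftrightarrow> (AE V in iid_uniform. Q (?walk stack_index V))"
    by (rule AE)
  also have "\<dots> \<longleftrightarrow> (AE V in iid_uniform. Q (walk (arrows (\<omega>, V))))"
    by (simp only: walk)
  finally show ?thesis .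
qed

theorem theorem1p2:
  fixes \<mu> :: "cookie_env measure"
  assumes "prob_space \<mu>"
    and "sets \<mu> = sets cookie_M"
    and "stationary \<mu>"
    and "ergodic \<mu>"
    and "elliptic \<mu>"
  shows "\<exists>v::real. -1 \<le> v \<and> v \<le> 1 \<and>
    measure (annealed \<mu>)
      {(\<omega>, U). (\<lambda>n. real_of_int (erw 0 \<omega> U n) / real n) \<longlonglongrightarrow> v} = 1"
proof -
  interpret cookie_law \<mu>
    using assms by (intro cookie_law.intro cookie_law_axioms.intro)
  have uniforms: "uniforms = iid_uniform" by (simp add: uniforms_def iid_uniform_def)
  interpret A: pair_prob_space \<mu> uniforms
    unfolding uniforms by unfold_locales
  obtain v where v: "\<bar>v\<bar> \<le> 1"
    and conv: "AE s in env. (\<lambda>n. real_of_int (walk (arrows s) n) / real n) \<longlonglongrightarrow> v"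
    using AE_walk_converges[OF arrow_system_right arrow_system_left] by blast
  let ?Q = "\<lambda>x :: nat \<Rightarrow> int. (\<lambda>n. real_of_int (x n) / real n) \<longlonglongrightarrow> v"
  have Q: "Measurable.pred (PiM UNIV (\<lambda>_. count_space UNIV)) ?Q"
    by (rule pred_tendsto) measurable
  \<comment> \<open>The two walks live on different probability spaces, so the transfer is made for
    almost every fixed \<open>\<omega>\<close> and the annealed statement is reassembled
    afterwards.\<close>
  from P.AE_pair[OF conv] have "AE \<omega> in \<mu>. AE V in iid_uniform. ?Q (walk (arrows (\<omega>, V)))" .
  then have AE: "AE \<omega> in \<mu>. AE U in uniforms. ?Q (erw 0 \<omega> U)"
    by (simp only: AE_erw_iff_AE_walk[OF Q])
  note measurable_uniforms [measurable]
  \<comment> \<open>Joint measurability of the convergence event is what allows the return from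
    almost every section to the product measure.\<close>
  have "(\<lambda>s. coin_path (\<lambda>q. snd s (length q - 1) < fst s (fst (stack_index q)) (snd (stack_index q))) n)
      \<in> measurable (annealed \<mu>) (count_space UNIV)" for n
    unfolding annealed_def by (rule measurable_coin_path) measurable
  then have "(\<lambda>s. erw 0 (fst s) (snd s) n) \<in> measurable (annealed \<mu>) (count_space UNIV)" for n
    unfolding erw_coin_path by (rule measurable_compose) simp
  then have "Measurable.pred (annealed \<mu>) (\<lambda>s. ?Q (erw 0 (fst s) (snd s)))"
    by (intro pred_tendsto) measurable
  then have S: "{s\<in>space (annealed \<mu>). ?Q (erw 0 (fst s) (snd s))} \<in> sets (annealed \<mu>)"
    by simp
  have "AE s in annealed \<mu>. ?Q (erw 0 (fst s) (snd s))"
    using S AE unfolding annealed_def by (intro A.AE_pair_measure) simp_all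
  then have "measure (annealed \<mu>) {s\<in>space (annealed \<mu>). ?Q (erw 0 (fst s) (snd s))} = 1"
    using S A.prob_Collect_eq_1[of "\<lambda>s. ?Q (erw 0 (fst s) (snd s))"] unfolding annealed_def by simp
  moreover have "{s\<in>space (annealed \<mu>). ?Q (erw 0 (fst s) (snd s))} = {(\<omega>, U). ?Q (erw 0 \<omega> U)}"
    by (auto simp: annealed_def uniforms space_pair_measure)
  ultimately show ?thesis using v by (intro exI[of _ v]) (auto simp: abs_le_iff)
qed

end
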